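(* Let $\mathcal B$ be a finite set of complex numbers $\beta$ with $\mathrm{Re}(\beta)\ge\gamma\ge1$ for all $\beta\in\mathcal B$, let $s>0$, and for $\beta\in\mathcal B$ let $\theta_\beta(z)=(z+\beta)^{-1}$. Let $H$ be a bounded, mildly regular open subset of $\mathbb C=\mathbb R^2$ such that $H\supset G_\gamma:=\{z\in\mathbb C:|z-1/(2\gamma)|<1/(2\gamma)\}$ and $\mathrm{Re}(z)>0$ for all $z\in H$. For a positive integer $m$, define $\Lambda_s:C^m(\bar H)\to C^m(\bar H)$ by $$(\Lambda_sf)(z)=\sum_{\beta\in\mathcal B}\Big|\frac{d}{dz}\theta_\beta(z)\Big|^sf(\theta_\beta(z))=\sum_{\beta\in\mathcal B}|z+\beta|^{-2s}f(\theta_\beta(z)).$$ Then $\Lambda_s$ has a unique (up to normalization) positive eigenvector $v_s\in C^m(\bar H)$, $v_s$ is $C^\infty$, and writing $z=(x,y)$, for all $(x,y)\in\bar H$: $$-\frac{2s}{\gamma}\le\frac{\partial_xv_s}{v_s}\le0,\qquad -\frac{s}{4\gamma^2(s+1)}\le\frac{\partial_x^2v_s}{v_s}\le\frac{2s(2s+1)}{\gamma^2},$$ $$-\frac{2s(2s+1)(2s+2)}{\gamma^3}\le\frac{\partial_x^3v_s}{v_s}\le\frac{(2s)(2s+2)}{\gamma^3(s+2)^2},\qquad -\frac{2s(2s+2)(3s+3)}{\gamma^4}\le\frac{\partial_x^4v_s}{v_s}\le\frac{(2s)(2s+1)(2s+2)(2s+3)}{\gamma^4},$$ $$\frac{|\partial_yv_s|}{v_s}\le\frac{s}{\gamma},\qquad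 -\frac{2s}{\gamma^2}\le\frac{\partial_y^2v_s}{v_s}\le\frac{2s(2s+1)}{4\gamma^2},$$ $$\frac{|\partial_y^3v_s|}{v_s}\le\frac{(2s)(2s+2)}{\gamma^3}\max\{25\sqrt5/72,(2s+1)/8\},\qquad -\frac{2s(2s+2)(3s+3)}{\gamma^4}\le\frac{\partial_y^4v_s}{v_s}\le\frac{(2s)(2s+1)(2s+2)(2s+3)}{\gamma^4}.$$ Hence, with $D_1=\partial/\partial x$, $D_2=\partial/\partial y$, for $k=1,2$ and $1\le j\le4$, $$\frac{|D_k^jv_s(x,y)|}{v_s(x,y)}\le\frac{(2s)(2s+1)\cdots(2s+j-1)}{\gamma^j}.$$
   Context: $H$ is mildly regular if there exist $\eta>0$, $M\ge1$ such that whenever $x,y\in H$ with $\|x-y\|<\eta$ there is a Lipschitz $\psi:[0,1]\to H$ with $\psi(0)=x$, $\psi(1)=y$, $\int_0^1\|\psi'(t)\|dt\le M\|x-y\|$. $C^m(\bar H)$ is the Banach space of real $C^m$ functions on $H$ all of whose partial derivatives of order $\le m$ extend continuously to $\bar H$. A positive eigenvector means an eigenvector $v_s$ with $v_s(z)>0$ for all $z\in\bar H$. *)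

theory Defs
  imports "HOL-Analysis.Analysis"
begin

definition mildly_regular :: "complex set \<Rightarrow> bool" where
  "mildly_regular H \<longleftrightarrow>
     (\<exists>\<eta>>0. \<exists>M\<ge>1. \<forall>x\<in>H. \<forall>y\<in>H. norm (x - y) < \<eta> \<longrightarrow>
        (\<exists>\<psi> :: real \<Rightarrow> complex. \<exists>\<psi>' :: real \<Rightarrow> complex. \<exists>L. \<exists>N.
            L-lipschitz_on {0..1} \<psi> \<and> \<psi> ` {0..1} \<subseteq> H \<and> \<psi> 0 = x \<and> \<psi> 1 = y \<and>
            negligible N \<and>
            (\<forall>t\<in>{0..1} - N. (\<psi> has_vector_derivative \<psi>' t) (at t within {0..1})) \<and>
            (\<lambda>t. norm (\<psi>' t)) integrable_on {0..1} \<and>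
            integral {0..1} (\<lambda>t. norm (\<psi>' t)) \<le> M * norm (x - y)))"

definition dpart :: "complex \<Rightarrow> (complex \<Rightarrow> real) \<Rightarrow> complex \<Rightarrow> real" where
  "dpart e f z = deriv (\<lambda>t::real. f (z + of_real t * e)) 0"

fun pd :: "complex list \<Rightarrow> (complex \<Rightarrow> real) \<Rightarrow> complex \<Rightarrow> real" where
  "pd [] f = f"
| "pd (e # es) f = dpart e (pd es f)"

text \<open>f belongs to C^m(closure H): all partial derivatives of order \<le> m exist
  (classically) and are continuous on H and extend continuously to closure H.
  An element is represented by a function whose values on closure H are the
  continuous extension of f (so f itself is continuous on closure H).\<close>
definition Cm_bar :: "nat \<Rightarrow> complex set \<Rightarrow> (complex \<Rightarrow> real) \<Rightarrow> bool" where
  "Cm_bar m H f \<longleftrightarrow>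
     continuous_on (closure H) f \<and>
     (\<forall>es. set es \<subseteq> {1, \<i>} \<and> length es < m \<longrightarrow>
        (\<forall>z\<in>H. \<forall>e\<in>{1, \<i>}. \<exists>D. ((\<lambda>t::real. pd es f (z + of_real t * e)) has_real_derivative D) (at 0))) \<and>
     (\<forall>es. set es \<subseteq> {1, \<i>} \<and> length es \<le> m \<longrightarrow>
        continuous_on H (pd es f) \<and>
        (\<exists>g. continuous_on (closure H) g \<and> (\<forall>z\<in>H. g z = pd es f z)))"

definition pd_bar :: "complex set \<Rightarrow> complex list \<Rightarrow> (complex \<Rightarrow> real) \<Rightarrow> complex \<Rightarrow> real" where
  "pd_bar H es f z = Lim (at z within H) (pd es f)"

definition Lam :: "complex set \<Rightarrow> real \<Rightarrow> (complex \<Rightarrow> real) \<Rightarrow> complex \<Rightarrow> real" where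
  "Lam B s f z = (\<Sum>\<beta>\<in>B. (cmod (deriv (\<lambda>w. inverse (w + \<beta>)) z)) powr s * f (inverse (z + \<beta>)))"

definition pos_eigvec :: "nat \<Rightarrow> complex set \<Rightarrow> complex set \<Rightarrow> real \<Rightarrow> (complex \<Rightarrow> real) \<Rightarrow> bool" where
  "pos_eigvec m H B s v \<longleftrightarrow> Cm_bar m H v \<and> (\<forall>z\<in>closure H. v z > 0) \<and>
     (\<exists>\<mu>::real. \<forall>z\<in>closure H. Lam B s v z = \<mu> * v z)"

end

theory Submission
  imports Defs
begin

text \<open>The kernel k(z, b) = |z + b|^(-2s) with Re b \<ge> \<gamma> intertwines the transfer operator in z with
  the dual operator T in b, which sends f to the sum over \<beta> of |b|^(-2s) f(\<beta> + 1/b).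
  A positive eigenfunctional L of T, obtained by averaging the orbit of a point mass, thus gives
  the eigenvector v(z) = L(b \<mapsto> k(z, b)). Partial derivatives of v are obtained by applying L to those
  of k, so it is enough to bound the ratios (derivative of k) / k for a single b, and these are ratios of
  polynomials in Re (z + b) and Im (z + b). For uniqueness, the ratio of two eigenvectors takes its
  maximum along a whole orbit of one branch and its minimum along another such orbit. The square of
  the branch contracts, so the two orbits approach each other and the ratio is constant.\<close>

section \<open>Partial derivatives of the kernel\<close>

text \<open>The kernel is found by iterating: for n >= 1 the n-th iterate of the transfer operator
  on the constant 1 is a positive combination of functions |z + b|^(-2s), where b runs over finite
  continued fractions with digits in \<open>B\<close>. These b lie in a bounded part of the half
  plane Re b >= \<gamma>, so an eigenvector should be a positive average of kernels over such a set.
  Two obstacles shape the proof. The averaging functional comes from compactness and is only known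
  to be linear and positive, so no convergence theorem can be applied to it; every limit taken
  through it must rest on estimates uniform in b. Hence the Lipschitz and second-order Taylor bounds
  on half planes, proved for a class containing all derivatives of the kernel. Secondly, the limit
  must not degenerate to zero: the orbit has to be normalised by powers r^n that match its size from
  both sides, and this follows from a Harnack inequality whose constant is independent of n.\<close>

definition nsq :: "complex \<Rightarrow> real" where
  "nsq z = (Re z)\<^sup>2 + (Im z)\<^sup>2"

lemma nsq_eq_cmod: "nsq z = (cmod z)\<^sup>2"
  by (simp add: nsq_def cmod_power2)

lemma nsq_pos: "Re z > 0 \<Longrightarrow> nsq z > 0"
  by (simp add: nsq_def add_pos_nonneg)

lemma nsq_mult: "nsq (z * w) = nsq z * nsq w"
  by (simp add: nsq_eq_cmod norm_mult power_mult_distrib)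

text \<open>Pulling out \<open>nsq w powr (- q - 1)\<close> keeps the numerator a polynomial if P is
  one. The resulting recursion on numerators gives both the closure of the symbols below under
  differentiation and the explicit derivatives of the kernel.\<close>

lemma has_real_derivative_nsq_powr:
  fixes P :: "complex \<Rightarrow> real"
  assumes P: "((\<lambda>t. P (w + of_real t * e)) has_real_derivative P') (at 0)"
    and "Re w > 0" "e \<in> {1, \<i>}"
  shows "((\<lambda>t. P (w + of_real t * e) * nsq (w + of_real t * e) powr (- q)) has_real_derivative
           (P' * nsq w - 2 * q * (if e = 1 then Re w else Im w) * P w) * nsq w powr (- q - 1)) (at 0)"
proof -
  have n: "nsq w > 0" using assms nsq_pos by blast
  have N: "((\<lambda>t. nsq (w + of_real t * e)) has_real_derivative 2 * (if e = 1 then Re w else Im w)) (at 0)"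
    using \<open>e \<in> {1, \<i>}\<close> by (auto simp: nsq_def intro!: derivative_eq_intros)
  have R: "((\<lambda>t. nsq (w + of_real t * e) powr (- q)) has_real_derivative
      (- q) * nsq w powr (- q - 1) * (2 * (if e = 1 then Re w else Im w))) (at 0)"
    using DERIV_fun_powr[OF N, of "- q"] n by simp
  have q: "nsq w powr (- q) = nsq w * nsq w powr (- q - 1)"
    using n by (simp add: powr_diff)
  show ?thesis
    using DERIV_mult[OF P R] by (rule back_subst[where P = "\<lambda>D. (_ has_real_derivative D) _"])
      (use q in \<open>simp add: algebra_simps\<close>)
qed

text \<open>A class that contains the kernel and is closed under partial derivatives. The condition on the
  exponents makes its members bounded on half planes Re z \<ge> \<delta> > 0.\<close>

inductive symbol :: "(complex \<Rightarrow> real) \<Rightarrow> bool" where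
  monomial: "real (a + b) \<le> 2 * p \<Longrightarrow> symbol (\<lambda>z. c * Re z ^ a * Im z ^ b * nsq z powr (- p))"
| add: "symbol f \<Longrightarrow> symbol g \<Longrightarrow> symbol (\<lambda>z. f z + g z)"

text \<open>Differentiating the polynomial factor of a monomial kills it or lowers
  \<open>a + b\<close> by one with \<open>p\<close> fixed; differentiating the power of
  \<open>nsq\<close> raises \<open>a + b\<close> by one and \<open>2 * p\<close> by two. Both
  preserve the condition on the exponents.\<close>

lemma symbol_deriv:
  assumes "symbol f" "e \<in> {1, \<i>}"
  shows "\<exists>f'. symbol f' \<and> (\<forall>z. Re z > 0 \<longrightarrow>
           ((\<lambda>t::real. f (z + of_real t * e)) has_real_derivative f' z) (at 0))"
  using assms
proof (induction rule: symbol.induct)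
  case (monomial a b p c)
  \<comment> \<open>The truncated \<open>a - 1\<close> and \<open>b - 1\<close> are harmless at 0,
    where the factors \<open>real a\<close> and \<open>real b\<close> vanish.\<close>
  define P' where "P' = (\<lambda>z. if e = 1 then c * (real a * Re z ^ (a - 1)) * Im z ^ b
                              else c * Re z ^ a * (real b * Im z ^ (b - 1)))"
  have P: "((\<lambda>t::real. c * Re (z + of_real t * e) ^ a * Im (z + of_real t * e) ^ b) has_real_derivative P' z) (at 0)" for z
    using monomial by (auto simp: P'_def intro!: derivative_eq_intros)
  let ?f' = "\<lambda>z. P' z * nsq z powr (- p) + 
     (- 2 * p * c) * Re z ^ (if e = 1 then Suc a else a) * Im z ^ (if e = 1 then b else Suc b) * nsq z powr (- (p + 1))"
  have "symbol (\<lambda>z. P' z * nsq z powr (- p))"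
  proof (cases "e = 1")
    case True
    show ?thesis using symbol.monomial[of "a - 1" b p "c * real a"] monomial True
      by (simp add: P'_def mult.assoc)
  next
    case False
    show ?thesis using symbol.monomial[of a "b - 1" p "c * real b"] monomial False
      by (simp add: P'_def mult.assoc mult.left_commute)
  qed
  then have "symbol ?f'"
    by (rule symbol.add[OF _ symbol.monomial]) (use monomial in auto)
  moreover have "((\<lambda>t::real. c * Re (z + of_real t * e) ^ a * Im (z + of_real t * e) ^ b * nsq (z + of_real t * e) powr (- p))
      has_real_derivative ?f' z) (at 0)" if z: "Re z > 0" for z
  proof -
    define r where "r = nsq z powr (- p - 1)"
    have n: "nsq z powr (- p) = nsq z * r" "nsq z powr (- 1 - p) = r"
      using nsq_pos[OF z] by (simp add: r_def powr_diff, simp add: r_def minus_diff_commute)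
    show ?thesis
      using has_real_derivative_nsq_powr[OF P z \<open>e \<in> {1, \<i>}\<close>, of p]
      unfolding r_def[symmetric]
      by (rule back_subst[where P = "\<lambda>D. (_ has_real_derivative D) _"])
        (use monomial in \<open>auto simp: n algebra_simps\<close>)
  qed
  ultimately show ?case by (intro exI[of _ ?f']) blast
next
  case (add f g)
  then obtain f' g' where "symbol f'" "symbol g'"
    "\<forall>z. Re z > 0 \<longrightarrow> ((\<lambda>t::real. f (z + of_real t * e)) has_real_derivative f' z) (at 0)"
    "\<forall>z. Re z > 0 \<longrightarrow> ((\<lambda>t::real. g (z + of_real t * e)) has_real_derivative g' z) (at 0)"
    by blast
  then show ?case
    by (intro exI[of _ "\<lambda>z. f' z + g' z"]) (auto intro: symbol.add DERIV_add)
qed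

text \<open>A monomial is at most a constant times |z|^(a + b - 2p). This exponent is nonpositive
  and |z| >= Re z, so the value at radius \<delta> dominates.\<close>

lemma symbol_bounded:
  assumes "symbol f" "\<delta> > 0"
  shows "\<exists>C\<ge>0. \<forall>z. Re z \<ge> \<delta> \<longrightarrow> \<bar>f z\<bar> \<le> C"
  using assms
proof (induction rule: symbol.induct)
  case (monomial a b p c)
  have "\<bar>c * Re z ^ a * Im z ^ b * nsq z powr (- p)\<bar> \<le> \<bar>c\<bar> * \<delta> powr (real (a + b) - 2 * p)"
    if z: "Re z \<ge> \<delta>" for z
  proof -
    have n: "cmod z \<ge> \<delta>" using z complex_Re_le_cmod[of z] by linarith
    have "nsq z powr (- p) = cmod z powr (- 2 * p)"
      using n \<open>\<delta> > 0\<close> by (simp add: nsq_eq_cmod powr_powr flip: powr_numeral)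
    then have "\<bar>c * Re z ^ a * Im z ^ b * nsq z powr (- p)\<bar>
        = \<bar>c\<bar> * (\<bar>Re z\<bar> ^ a * \<bar>Im z\<bar> ^ b * cmod z powr (- 2 * p))"
      by (simp add: abs_mult power_abs)
    also have "\<dots> \<le> \<bar>c\<bar> * (cmod z ^ a * cmod z ^ b * cmod z powr (- 2 * p))"
      by (intro mult_left_mono mult_right_mono mult_mono power_mono abs_Re_le_cmod abs_Im_le_cmod) auto
    also have "\<dots> = \<bar>c\<bar> * cmod z powr (real (a + b) - 2 * p)"
      using n \<open>\<delta> > 0\<close> by (simp add: powr_diff powr_add powr_realpow powr_minus divide_simps)
    also have "\<dots> \<le> \<bar>c\<bar> * \<delta> powr (real (a + b) - 2 * p)"
      using n monomial by (intro mult_left_mono powr_mono2') auto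
    finally show ?thesis .
  qed
  then show ?case by (intro exI[of _ "\<bar>c\<bar> * \<delta> powr (real (a + b) - 2 * p)"]) auto
next
  case (add f g)
  then obtain C D where "C \<ge> 0" "D \<ge> 0" "\<forall>z. Re z \<ge> \<delta> \<longrightarrow> \<bar>f z\<bar> \<le> C" "\<forall>z. Re z \<ge> \<delta> \<longrightarrow> \<bar>g z\<bar> \<le> D"
    by blast
  then show ?case
    by (intro exI[of _ "C + D"]) (auto intro: order_trans[OF abs_triangle_ineq] add_mono)
qed

section \<open>Uniform Lipschitz and Taylor estimates for symbols\<close>

lemma has_real_derivative_line_shift:
  fixes f :: "complex \<Rightarrow> real"
  assumes "((\<lambda>t::real. f ((z + of_real u * e) + of_real t * e)) has_real_derivative D) (at 0)"
  shows "((\<lambda>t::real. f (z + of_real t * e)) has_real_derivative D) (at u)"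
proof -
  have "((\<lambda>t::real. f (z + of_real (u + t) * e)) has_real_derivative D) (at 0)"
    using assms by (simp add: algebra_simps)
  then show ?thesis
    using DERIV_shift[of "\<lambda>t::real. f (z + of_real t * e)" D 0 u] by (simp add: add.commute)
qed

lemma Re_segment_gt:
  assumes "Re z > \<delta>" "Re (z + of_real t * e) > \<delta>" "u \<in> closed_segment 0 t" "e \<in> {1, \<i>}"
  shows "Re (z + of_real u * e) > \<delta>"
  using assms by (auto simp: closed_segment_eq_real_ivl split: if_splits)

lemma symbol_lipschitz_line:
  assumes "symbol f" "\<delta> > 0" "e \<in> {1, \<i>}"
  shows "\<exists>C\<ge>0. \<forall>z t. Re z > \<delta> \<longrightarrow> Re (z + of_real t * e) > \<delta> \<longrightarrow> \<bar>f (z + of_real t * e) - f z\<bar> \<le> C * \<bar>t\<bar>"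
proof -
  obtain f' where f': "symbol f'"
    "\<And>z. Re z > 0 \<Longrightarrow> ((\<lambda>t::real. f (z + of_real t * e)) has_real_derivative f' z) (at 0)"
    using symbol_deriv[OF assms(1,3)] by blast
  obtain C where C: "C \<ge> 0" "\<And>z. Re z \<ge> \<delta> \<Longrightarrow> \<bar>f' z\<bar> \<le> C"
    using symbol_bounded[OF f'(1) assms(2)] by blast
  have "\<bar>f (z + of_real t * e) - f z\<bar> \<le> C * \<bar>t\<bar>" if z: "Re z > \<delta>" "Re (z + of_real t * e) > \<delta>" for z t
  proof -
    have "norm (f (z + of_real t * e) - f (z + of_real 0 * e)) \<le> C * norm (t - 0)"
    proof (rule field_differentiable_bound[where S = "closed_segment 0 t" and f' = "\<lambda>u. f' (z + of_real u * e)"])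
      fix u assume u: "u \<in> closed_segment 0 t"
      have r: "Re (z + of_real u * e) > \<delta>" by (rule Re_segment_gt[OF z u assms(3)])
      then show "norm (f' (z + of_real u * e)) \<le> C" using C(2) by simp
      show "((\<lambda>u. f (z + of_real u * e)) has_field_derivative f' (z + of_real u * e)) (at u within closed_segment 0 t)"
        using has_real_derivative_line_shift[OF f'(2)] r assms(2) by (meson has_field_derivative_at_within less_trans)
    qed auto
    then show ?thesis by simp
  qed
  with C(1) show ?thesis by blast
qed

lemma symbol_lipschitz:
  assumes "symbol f" "\<delta> > 0"
  shows "\<exists>C\<ge>0. \<forall>z w. Re z > \<delta> \<longrightarrow> Re w > \<delta> \<longrightarrow> \<bar>f w - f z\<bar> \<le> C * cmod (w - z)"
proof -
  obtain C where C: "C \<ge> 0" 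
    "\<And>z t. Re z > \<delta> \<Longrightarrow> Re (z + of_real t * 1) > \<delta> \<Longrightarrow> \<bar>f (z + of_real t * 1) - f z\<bar> \<le> C * \<bar>t\<bar>"
    using symbol_lipschitz_line[OF assms, of 1] by blast
  obtain D where D: "D \<ge> 0" 
    "\<And>z t. Re z > \<delta> \<Longrightarrow> Re (z + of_real t * \<i>) > \<delta> \<Longrightarrow> \<bar>f (z + of_real t * \<i>) - f z\<bar> \<le> D * \<bar>t\<bar>"
    using symbol_lipschitz_line[OF assms, of \<i>] by blast
  have "\<bar>f w - f z\<bar> \<le> (C + D) * cmod (w - z)" if "Re z > \<delta>" "Re w > \<delta>" for z w
  proof -
    \<comment> \<open>The corner of a horizontal followed by a vertical move. It has the real part
      of w, so the path stays in the half plane.\<close>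
    let ?u = "z + of_real (Re (w - z)) * 1"
    have w: "w = ?u + of_real (Im (w - z)) * \<i>" by (simp add: complex_eq_iff)
    have 1: "\<bar>f ?u - f z\<bar> \<le> C * \<bar>Re (w - z)\<bar>" using that by (intro C(2)) auto
    have 2: "\<bar>f w - f ?u\<bar> \<le> D * \<bar>Im (w - z)\<bar>" using D(2)[of ?u "Im (w - z)"] that w by simp
    have 3: "C * \<bar>Re (w - z)\<bar> \<le> C * cmod (w - z)" "D * \<bar>Im (w - z)\<bar> \<le> D * cmod (w - z)"
      using C(1) D(1) by (intro mult_left_mono abs_Re_le_cmod abs_Im_le_cmod; simp)+
    show ?thesis using 1 2 3 by (simp add: algebra_simps)
  qed
  with C(1) D(1) show ?thesis by (meson add_nonneg_nonneg)
qed

text \<open>The constant depends on neither z nor t, which later permits differentiation under a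
  merely positive functional. It comes from the mean value bound for u -> f (z + u e) - u f' z,
  whose derivative is O(|t|) because f' is again a Lipschitz symbol.\<close>

lemma symbol_taylor:
  assumes "symbol f" "symbol f'" "\<delta> > 0" "e \<in> {1, \<i>}"
    and f': "\<And>z. Re z > 0 \<Longrightarrow> ((\<lambda>t::real. f (z + of_real t * e)) has_real_derivative f' z) (at 0)"
  shows "\<exists>C\<ge>0. \<forall>z t. Re z > \<delta> \<longrightarrow> Re (z + of_real t * e) > \<delta> \<longrightarrow>
           \<bar>f (z + of_real t * e) - f z - t * f' z\<bar> \<le> C * t\<^sup>2"
proof -
  obtain C where C: "C \<ge> 0" "\<And>z t. Re z > \<delta> \<Longrightarrow> Re (z + of_real t * e) > \<delta> \<Longrightarrow>
      \<bar>f' (z + of_real t * e) - f' z\<bar> \<le> C * \<bar>t\<bar>"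
    using symbol_lipschitz_line[OF assms(2-4)] by blast
  have "\<bar>f (z + of_real t * e) - f z - t * f' z\<bar> \<le> C * t\<^sup>2" 
    if z: "Re z > \<delta>" "Re (z + of_real t * e) > \<delta>" for z t
  proof -
    have "norm ((f (z + of_real t * e) - t * f' z) - (f (z + of_real 0 * e) - 0 * f' z)) \<le> (C * \<bar>t\<bar>) * norm (t - 0)"
    proof (rule field_differentiable_bound[where S = "closed_segment 0 t" and f' = "\<lambda>u. f' (z + of_real u * e) - f' z"
          and f = "\<lambda>u. f (z + of_real u * e) - u * f' z"])
      fix u assume u: "u \<in> closed_segment 0 t"
      have r: "Re (z + of_real u * e) > \<delta>" by (rule Re_segment_gt[OF z u assms(4)])
      have "\<bar>u\<bar> \<le> \<bar>t\<bar>" using u by (auto simp: closed_segment_eq_real_ivl split: if_splits)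
      then show "norm (f' (z + of_real u * e) - f' z) \<le> C * \<bar>t\<bar>" 
        using C(2)[OF z(1) r] mult_left_mono[OF _ C(1)] by fastforce
      have "((\<lambda>u. f (z + of_real u * e)) has_real_derivative f' (z + of_real u * e)) (at u within closed_segment 0 t)"
        using has_real_derivative_line_shift[OF f'] r assms(3) by (meson has_field_derivative_at_within less_trans)
      then show "((\<lambda>u. f (z + of_real u * e) - u * f' z) has_field_derivative f' (z + of_real u * e) - f' z) (at u within closed_segment 0 t)"
        by (auto intro!: derivative_eq_intros)
    qed auto
    then show ?thesis by (simp add: power2_eq_square mult.assoc)
  qed
  with C(1) show ?thesis by blast
qed

section \<open>The kernel and its pure derivatives up to order four\<close>

definition riesz_kernel :: "real \<Rightarrow> complex \<Rightarrow> real" where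
  "riesz_kernel s z = nsq z powr (- s)"

lemma riesz_kernel_pos: "Re z > 0 \<Longrightarrow> riesz_kernel s z > 0"
  using nsq_pos[of z] by (simp add: riesz_kernel_def)

lemma symbol_riesz_kernel: "s \<ge> 0 \<Longrightarrow> symbol (riesz_kernel s)"
  using symbol.monomial[of 0 0 s 1] by (simp add: riesz_kernel_def[abs_def])

lemma eventually_Re_line: "Re z > \<delta> \<Longrightarrow> \<forall>\<^sub>F t::real in nhds 0. Re (z + of_real t * e) > \<delta>"
proof -
  assume "Re z > \<delta>"
  have "isCont (\<lambda>t::real. Re (z + of_real t * e)) 0"
    by simp
  then have "((\<lambda>t::real. Re (z + of_real t * e)) \<longlongrightarrow> Re z) (nhds 0)"
    by (simp add: continuous_within tendsto_nhds_iff)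
  then show ?thesis using \<open>Re z > \<delta>\<close> order_tendstoD(1) by blast
qed

text \<open>Formulas for iterated derivatives are known on a half plane only, while
  \<open>dpart\<close> evaluates a function along a full line. Since the half plane is open, the two
  functions agree for small t, which is all that \<open>deriv\<close> sees.\<close>

lemma dpart_eq:
  assumes "\<And>w. Re w > \<delta> \<Longrightarrow> f w = g w" "Re z > \<delta>"
    "((\<lambda>t::real. g (z + of_real t * e)) has_real_derivative D) (at 0)"
  shows "((\<lambda>t::real. f (z + of_real t * e)) has_real_derivative D) (at 0)" "dpart e f z = D"
proof -
  have ev: "\<forall>\<^sub>F t::real in nhds 0. f (z + of_real t * e) = g (z + of_real t * e)"
    using eventually_Re_line[OF assms(2)] by eventually_elim (use assms(1) in blast)
  show "((\<lambda>t::real. f (z + of_real t * e)) has_real_derivative D) (at 0)"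
    by (rule DERIV_cong_ev[OF refl ev refl, THEN iffD2, OF assms(3)])
  then show "dpart e f z = D" by (simp add: dpart_def DERIV_imp_deriv)
qed

lemma dpart_nsq_powr:
  assumes f: "\<And>w. Re w > 0 \<Longrightarrow> f w = P w * nsq w powr (- q)"
    and P: "((\<lambda>t. P (w + of_real t * e)) has_real_derivative P') (at 0)"
    and "Re w > 0" "e \<in> {1, \<i>}"
    and "P' * nsq w - 2 * q * (if e = 1 then Re w else Im w) * P w = Q"
  shows "dpart e f w = Q * nsq w powr (- (q + 1))"
  using dpart_eq(2)[OF f assms(3) has_real_derivative_nsq_powr[OF P assms(3,4)]] assms(5)
  by simp

lemma pd_riesz_kernel_1:
  assumes "Re w > 0"
  shows "pd [1] (riesz_kernel s) w = (- 2 * s * Re w) * nsq w powr (- (s + 1))"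
  unfolding pd.simps
  by (rule dpart_nsq_powr[where P = "\<lambda>_. 1" and P' = 0]) (use assms in \<open>auto simp: riesz_kernel_def\<close>)

lemma pd_riesz_kernel_i:
  assumes "Re w > 0"
  shows "pd [\<i>] (riesz_kernel s) w = (- 2 * s * Im w) * nsq w powr (- (s + 1))"
  unfolding pd.simps
  by (rule dpart_nsq_powr[where P = "\<lambda>_. 1" and P' = 0]) (use assms in \<open>auto simp: riesz_kernel_def\<close>)

text \<open>From here on exponents are kept as \<open>s + 1 + 1\<close> and so on, so that each
  formula matches the premise of \<open>dpart_nsq_powr\<close> for the next order.\<close>

lemma pd_riesz_kernel_11:
  assumes "Re w > 0"
  shows "pd [1, 1] (riesz_kernel s) w = (2 * s * ((2 * s + 1) * (Re w)\<^sup>2 - (Im w)\<^sup>2)) * nsq w powr (- (s + 1 + 1))"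
  by (subst pd.simps, rule dpart_nsq_powr[OF pd_riesz_kernel_1, where P' = "- 2 * s"])
    (use assms in \<open>auto simp: nsq_def algebra_simps power2_eq_square intro!: derivative_eq_intros\<close>)

lemma pd_riesz_kernel_ii:
  assumes "Re w > 0"
  shows "pd [\<i>, \<i>] (riesz_kernel s) w = (2 * s * ((2 * s + 1) * (Im w)\<^sup>2 - (Re w)\<^sup>2)) * nsq w powr (- (s + 1 + 1))"
  by (subst pd.simps, rule dpart_nsq_powr[OF pd_riesz_kernel_i, where P' = "- 2 * s"])
    (use assms in \<open>auto simp: nsq_def algebra_simps power2_eq_square intro!: derivative_eq_intros\<close>)

lemma pd_riesz_kernel_111:
  assumes "Re w > 0"
  shows "pd [1, 1, 1] (riesz_kernel s) w =
    (- (2 * s * (2 * s + 2)) * (Re w * ((2 * s + 1) * (Re w)\<^sup>2 - 3 * (Im w)\<^sup>2))) * nsq w powr (- (s + 1 + 1 + 1))"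
  by (subst pd.simps, rule dpart_nsq_powr[OF pd_riesz_kernel_11, where P' = "2 * s * ((2 * s + 1) * (2 * Re w))"])
    (use assms in \<open>auto simp: nsq_def algebra_simps power2_eq_square intro!: derivative_eq_intros\<close>)

lemma pd_riesz_kernel_iii:
  assumes "Re w > 0"
  shows "pd [\<i>, \<i>, \<i>] (riesz_kernel s) w =
    (- (2 * s * (2 * s + 2)) * (Im w * ((2 * s + 1) * (Im w)\<^sup>2 - 3 * (Re w)\<^sup>2))) * nsq w powr (- (s + 1 + 1 + 1))"
  by (subst pd.simps, rule dpart_nsq_powr[OF pd_riesz_kernel_ii, where P' = "2 * s * ((2 * s + 1) * (2 * Im w))"])
    (use assms in \<open>auto simp: nsq_def algebra_simps power2_eq_square intro!: derivative_eq_intros\<close>)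

text \<open>The numerator of the pure fourth derivatives. As \<open>nsq\<close> is symmetric in the
  two coordinates, one polynomial serves both directions with its arguments exchanged.\<close>

definition quartic :: "real \<Rightarrow> real \<Rightarrow> real \<Rightarrow> real" where
  "quartic s x y = 2 * s * (2 * s + 2) *
     ((2 * s + 1) * (2 * s + 3) * x ^ 4 - 6 * (2 * s + 3) * (x\<^sup>2 * y\<^sup>2) + 3 * y ^ 4)"

lemma pd_riesz_kernel_1111:
  assumes "Re w > 0"
  shows "pd [1, 1, 1, 1] (riesz_kernel s) w = quartic s (Re w) (Im w) * nsq w powr (- (s + 1 + 1 + 1 + 1))"
  by (subst pd.simps, rule dpart_nsq_powr[OF pd_riesz_kernel_111,
        where P' = "- (2 * s * (2 * s + 2)) * ((2 * s + 1) * (3 * (Re w)\<^sup>2) - 3 * (Im w)\<^sup>2)"])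
    (use assms in \<open>auto simp: quartic_def nsq_def algebra_simps power2_eq_square power4_eq_xxxx intro!: derivative_eq_intros\<close>)

lemma pd_riesz_kernel_iiii:
  assumes "Re w > 0"
  shows "pd [\<i>, \<i>, \<i>, \<i>] (riesz_kernel s) w = quartic s (Im w) (Re w) * nsq w powr (- (s + 1 + 1 + 1 + 1))"
  by (subst pd.simps, rule dpart_nsq_powr[OF pd_riesz_kernel_iii,
        where P' = "- (2 * s * (2 * s + 2)) * ((2 * s + 1) * (3 * (Im w)\<^sup>2) - 3 * (Re w)\<^sup>2)"])
    (use assms in \<open>auto simp: quartic_def nsq_def algebra_simps power2_eq_square power4_eq_xxxx intro!: derivative_eq_intros\<close>)

section \<open>Pointwise bounds for the kernel\<close>

text \<open>The j-th derivative divided by the kernel is P / nsq^j, so a bound for this ratio is a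
  polynomial inequality. The cases j = 1, ..., 4 are listed separately to match the unsimplified
  exponents of the derivative formulas.\<close>

lemma kernel_bounds:
  assumes "Re w > 0"
  shows "lo * nsq w ^ 1 \<le> P \<Longrightarrow> lo * riesz_kernel s w \<le> P * nsq w powr (- (s + 1))"
    and "P \<le> hi * nsq w ^ 1 \<Longrightarrow> P * nsq w powr (- (s + 1)) \<le> hi * riesz_kernel s w"
    and "lo * nsq w ^ 2 \<le> P \<Longrightarrow> lo * riesz_kernel s w \<le> P * nsq w powr (- (s + 1 + 1))"
    and "P \<le> hi * nsq w ^ 2 \<Longrightarrow> P * nsq w powr (- (s + 1 + 1)) \<le> hi * riesz_kernel s w"
    and "lo * nsq w ^ 3 \<le> P \<Longrightarrow> lo * riesz_kernel s w \<le> P * nsq w powr (- (s + 1 + 1 + 1))"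
    and "P \<le> hi * nsq w ^ 3 \<Longrightarrow> P * nsq w powr (- (s + 1 + 1 + 1)) \<le> hi * riesz_kernel s w"
    and "lo * nsq w ^ 4 \<le> P \<Longrightarrow> lo * riesz_kernel s w \<le> P * nsq w powr (- (s + 1 + 1 + 1 + 1))"
    and "P \<le> hi * nsq w ^ 4 \<Longrightarrow> P * nsq w powr (- (s + 1 + 1 + 1 + 1)) \<le> hi * riesz_kernel s w"
proof -
  have n: "nsq w > 0" by (rule nsq_pos[OF assms])
  have L: "lo * riesz_kernel s w \<le> P * nsq w powr (- q)" if "lo * nsq w ^ j \<le> P" "q = s + real j" for q P j
  proof -
    have "riesz_kernel s w = nsq w powr (real j + - q)" using that(2) by (simp add: riesz_kernel_def)
    also have "\<dots> = nsq w ^ j * nsq w powr (- q)"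
      unfolding powr_add using n by (simp add: powr_realpow)
    finally show ?thesis using mult_right_mono[OF that(1), of "nsq w powr (- q)"] by (simp add: mult.assoc)
  qed
  have U: "P * nsq w powr (- q) \<le> hi * riesz_kernel s w" if "P \<le> hi * nsq w ^ j" "q = s + real j" for q P j
  proof -
    have "riesz_kernel s w = nsq w powr (real j + - q)" using that(2) by (simp add: riesz_kernel_def)
    also have "\<dots> = nsq w ^ j * nsq w powr (- q)"
      unfolding powr_add using n by (simp add: powr_realpow)
    finally show ?thesis using mult_right_mono[OF that(1), of "nsq w powr (- q)"] by (simp add: mult.assoc)
  qed
  show "lo * nsq w ^ 1 \<le> P \<Longrightarrow> lo * riesz_kernel s w \<le> P * nsq w powr (- (s + 1))"
    using L[of 1 P "s + 1"] by simp
  show "P \<le> hi * nsq w ^ 1 \<Longrightarrow> P * nsq w powr (- (s + 1)) \<le> hi * riesz_kernel s w"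
    using U[of P 1 "s + 1"] by simp
  show "lo * nsq w ^ 2 \<le> P \<Longrightarrow> lo * riesz_kernel s w \<le> P * nsq w powr (- (s + 1 + 1))"
    using L[of 2 P "s + 1 + 1"] by simp
  show "P \<le> hi * nsq w ^ 2 \<Longrightarrow> P * nsq w powr (- (s + 1 + 1)) \<le> hi * riesz_kernel s w"
    using U[of P 2 "s + 1 + 1"] by simp
  show "lo * nsq w ^ 3 \<le> P \<Longrightarrow> lo * riesz_kernel s w \<le> P * nsq w powr (- (s + 1 + 1 + 1))"
    using L[of 3 P "s + 1 + 1 + 1"] by simp
  show "P \<le> hi * nsq w ^ 3 \<Longrightarrow> P * nsq w powr (- (s + 1 + 1 + 1)) \<le> hi * riesz_kernel s w"
    using U[of P 3 "s + 1 + 1 + 1"] by simp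
  show "lo * nsq w ^ 4 \<le> P \<Longrightarrow> lo * riesz_kernel s w \<le> P * nsq w powr (- (s + 1 + 1 + 1 + 1))"
    using L[of 4 P "s + 1 + 1 + 1 + 1"] by simp
  show "P \<le> hi * nsq w ^ 4 \<Longrightarrow> P * nsq w powr (- (s + 1 + 1 + 1 + 1)) \<le> hi * riesz_kernel s w"
    using U[of P 4 "s + 1 + 1 + 1 + 1"] by simp
qed

section \<open>Polynomial inequalities in the coordinates x, y and N = x^2 + y^2\<close>

context
  fixes x y g s N :: real
  assumes x: "x \<ge> g" and g: "g > 0" and s: "s > 0" and N: "N = x\<^sup>2 + y\<^sup>2"
begin

text \<open>The last two bounds are the source of the powers of \<gamma>: x / N is at most 1 / g,
  whereas |y| / N is at most 1 / (2 g) by 2 x |y| <= N. The factors 1/2, 1/4 and 1/8 in the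
  estimates for y-derivatives come from this difference.\<close>

lemma N_bounds: "g\<^sup>2 \<le> N" "g\<^sup>2 \<le> x\<^sup>2" "x\<^sup>2 \<le> N" "y\<^sup>2 \<le> N" "N > 0" "g * x \<le> N" "2 * g * \<bar>y\<bar> \<le> N"
proof -
  show gx: "g\<^sup>2 \<le> x\<^sup>2" using x g by (simp add: power_mono)
  show "x\<^sup>2 \<le> N" "y\<^sup>2 \<le> N" using N by auto
  then show "g\<^sup>2 \<le> N" using gx by linarith
  moreover have "g\<^sup>2 > 0" using g by simp
  ultimately show "N > 0" by linarith
  have "g * x \<le> x * x" using x g by (intro mult_right_mono) auto
  then show "g * x \<le> N" using \<open>x\<^sup>2 \<le> N\<close> by (simp add: power2_eq_square)
  have "g * \<bar>y\<bar> \<le> x * \<bar>y\<bar>" using x by (intro mult_right_mono) auto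
  moreover have "2 * x * \<bar>y\<bar> \<le> N" using sum_squares_bound[of x "\<bar>y\<bar>"] N by simp
  ultimately show "2 * g * \<bar>y\<bar> \<le> N" by simp
qed

lemma poly_bounds_x1: "- 2 * s / g * N ^ 1 \<le> - 2 * s * x" "- 2 * s * x \<le> 0 * N ^ 1"
proof -
  have "2 * s * (g * x) \<le> 2 * s * N" using N_bounds(6) s by (intro mult_left_mono) auto
  then show "- 2 * s / g * N ^ 1 \<le> - 2 * s * x" using g by (simp add: field_simps)
  show "- 2 * s * x \<le> 0 * N ^ 1" using x g s by simp
qed

lemma poly_bounds_x2:
  "- s / (4 * g\<^sup>2 * (s + 1)) * N\<^sup>2 \<le> 2 * s * ((2 * s + 1) * x\<^sup>2 - y\<^sup>2)"
  "2 * s * ((2 * s + 1) * x\<^sup>2 - y\<^sup>2) \<le> 2 * s * (2 * s + 1) / g\<^sup>2 * N\<^sup>2"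
proof -
  let ?d = "(2 * s + 2) * x\<^sup>2 - N"
  have d: "(2 * s + 1) * x\<^sup>2 - y\<^sup>2 = ?d" by (simp add: N algebra_simps)
  have "0 \<le> N\<^sup>2 + 8 * (s + 1) * g\<^sup>2 * ?d"
  proof (cases "?d \<ge> 0")
    case True
    then show ?thesis using s by simp
  next
    case False
    \<comment> \<open>With X = (2s + 2) x^2, the quotient (X - N) / N^2 is least at N = 2 X, where
      it equals -1 / (4 X). This square certifies it and yields the constant s / (4 (s + 1)). As
      \<open>?d\<close> is negative here, replacing x^2 by the smaller g^2 only increases the
      expression.\<close>
    have "0 \<le> (N - 4 * (s + 1) * x\<^sup>2)\<^sup>2" by simp
    also have "\<dots> = N\<^sup>2 + 8 * (s + 1) * (x\<^sup>2 * ?d)" by (simp add: power2_eq_square algebra_simps)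
    also have "\<dots> \<le> N\<^sup>2 + 8 * (s + 1) * (g\<^sup>2 * ?d)"
      using False N_bounds(2) s by (intro add_left_mono mult_left_mono mult_right_mono_neg) auto
    finally show ?thesis by (simp add: mult.assoc)
  qed
  then have "0 \<le> s * (N\<^sup>2 + 8 * (s + 1) * g\<^sup>2 * ?d)"
    using s by (intro mult_nonneg_nonneg) auto
  then have "- s * N\<^sup>2 \<le> 2 * s * ?d * (4 * g\<^sup>2 * (s + 1))" by (simp add: algebra_simps)
  then have "- s * N\<^sup>2 / (4 * g\<^sup>2 * (s + 1)) \<le> 2 * s * ?d"
    using g s by (subst pos_divide_le_eq) auto
  then show "- s / (4 * g\<^sup>2 * (s + 1)) * N\<^sup>2 \<le> 2 * s * ((2 * s + 1) * x\<^sup>2 - y\<^sup>2)"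
    unfolding d by simp
  have "(2 * s + 1) * x\<^sup>2 - y\<^sup>2 \<le> (2 * s + 1) * N"
    using N_bounds(3) s by (smt (verit) mult_left_mono zero_le_power2)
  then have "g\<^sup>2 * ((2 * s + 1) * x\<^sup>2 - y\<^sup>2) \<le> g\<^sup>2 * ((2 * s + 1) * N)" by (intro mult_left_mono) auto
  also have "\<dots> \<le> N * ((2 * s + 1) * N)" using N_bounds s by (intro mult_right_mono) auto
  finally have "2 * s * (g\<^sup>2 * ((2 * s + 1) * x\<^sup>2 - y\<^sup>2)) \<le> 2 * s * (N * ((2 * s + 1) * N))"
    using s by (intro mult_left_mono) auto
  then show "2 * s * ((2 * s + 1) * x\<^sup>2 - y\<^sup>2) \<le> 2 * s * (2 * s + 1) / g\<^sup>2 * N\<^sup>2"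
    using g by (simp add: field_simps power2_eq_square)
qed

lemma poly_bounds_x3:
  "- 2 * s * (2 * s + 1) * (2 * s + 2) / g ^ 3 * N ^ 3
     \<le> - (2 * s * (2 * s + 2)) * (x * ((2 * s + 1) * x\<^sup>2 - 3 * y\<^sup>2))" (is ?A)
  "- (2 * s * (2 * s + 2)) * (x * ((2 * s + 1) * x\<^sup>2 - 3 * y\<^sup>2))
     \<le> (2 * s) * (2 * s + 2) / (g ^ 3 * (s + 2)\<^sup>2) * N ^ 3" (is ?B)
proof -
  have c: "2 * s * (2 * s + 2) \<ge> 0" using s by simp
  have "(g * x) ^ 3 \<le> N ^ 3" using N_bounds(6) x g by (intro power_mono) auto
  then have "(2 * s + 1) * (g * x) ^ 3 \<le> (2 * s + 1) * N ^ 3" using s by (intro mult_left_mono) auto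
  moreover have "x * ((2 * s + 1) * x\<^sup>2 - 3 * y\<^sup>2) \<le> (2 * s + 1) * x ^ 3"
    using x g by (simp add: power2_eq_square power3_eq_cube algebra_simps)
  then have "g ^ 3 * (x * ((2 * s + 1) * x\<^sup>2 - 3 * y\<^sup>2)) \<le> g ^ 3 * ((2 * s + 1) * x ^ 3)"
    using g by (intro mult_left_mono) auto
  ultimately have "g ^ 3 * (x * ((2 * s + 1) * x\<^sup>2 - 3 * y\<^sup>2)) \<le> (2 * s + 1) * N ^ 3"
    by (simp add: power_mult_distrib algebra_simps)
  then have "x * ((2 * s + 1) * x\<^sup>2 - 3 * y\<^sup>2) \<le> (2 * s + 1) * N ^ 3 / g ^ 3"
    using g by (simp add: field_simps)
  from mult_left_mono[OF this c] have
    "- (2 * s * (2 * s + 2) * ((2 * s + 1) * N ^ 3 / g ^ 3))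
       \<le> - (2 * s * (2 * s + 2) * (x * ((2 * s + 1) * x\<^sup>2 - 3 * y\<^sup>2)))"
    by (rule le_imp_neg_le)
  then show ?A by (simp add: divide_inverse algebra_simps)
  let ?k = "(s + 2) * x\<^sup>2" and ?d = "3 * N - 2 * ((s + 2) * x\<^sup>2)"
  have d: "x * ((2 * s + 1) * x\<^sup>2 - 3 * y\<^sup>2) = - (x * ?d)" by (simp add: N algebra_simps)
  have "g ^ 3 * (s + 2)\<^sup>2 * (x * ?d) \<le> N ^ 3"
  proof (cases "?d \<ge> 0")
    case True
    \<comment> \<open>Trading g^3 for x^3 makes the left side a function of N and k = (s + 2) x^2
      alone.\<close>
    have "g ^ 3 * x \<le> x ^ 3 * x" using x g by (intro mult_right_mono power_mono) auto
    also have "\<dots> = (x\<^sup>2)\<^sup>2" by (simp add: power2_eq_square power3_eq_cube)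
    finally have "g ^ 3 * x * ((s + 2)\<^sup>2 * ?d) \<le> (x\<^sup>2)\<^sup>2 * ((s + 2)\<^sup>2 * ?d)"
      using True by (intro mult_right_mono) auto
    also have "\<dots> = ?k\<^sup>2 * (3 * N - 2 * ?k)" by (simp add: power_mult_distrib)
    also have "\<dots> \<le> N ^ 3"
    proof -
      \<comment> \<open>For fixed k the quotient (3 N - 2 k) / N^3 is largest at N = k, with value 1
        / k^2; this is where (s + 2)^2 comes from. The double root at N = k gives the
        factorisation.\<close>
      have "0 \<le> (N - ?k)\<^sup>2 * (N + 2 * ?k)" using N_bounds(5) s by simp
      also have "\<dots> = N ^ 3 - ?k\<^sup>2 * (3 * N - 2 * ?k)" by algebra
      finally show ?thesis by simp
    qed
    finally show ?thesis by (simp add: algebra_simps)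
  next
    case False
    then have "x * ?d \<le> 0" using x g by (intro mult_nonneg_nonpos) auto
    then have "g ^ 3 * (s + 2)\<^sup>2 * (x * ?d) \<le> 0"
      using mult_nonneg_nonpos[of "g ^ 3 * (s + 2)\<^sup>2" "x * ?d"] g by simp
    also have "0 \<le> N ^ 3" using N_bounds(5) by simp
    finally show ?thesis .
  qed
  then have "x * ?d \<le> N ^ 3 / (g ^ 3 * (s + 2)\<^sup>2)" using g s by (simp add: field_simps)
  from mult_left_mono[OF this c] show ?B unfolding d by (simp add: mult_ac)
qed

lemma poly_bounds_quartic:
  assumes "(u = x \<and> w = y) \<or> (u = y \<and> w = x)"
  shows "- 2 * s * (2 * s + 2) * (3 * s + 3) / g ^ 4 * N ^ 4 \<le> quartic s u w"
    "quartic s u w \<le> (2 * s) * (2 * s + 1) * (2 * s + 2) * (2 * s + 3) / g ^ 4 * N ^ 4"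
proof -
  let ?Q = "(2 * s + 1) * (2 * s + 3) * u ^ 4 - 6 * (2 * s + 3) * (u\<^sup>2 * w\<^sup>2) + 3 * w ^ 4"
  have Nuw: "N = u\<^sup>2 + w\<^sup>2" using assms N by auto
  have "g ^ 4 * N\<^sup>2 \<le> N\<^sup>2 * N\<^sup>2"
    using power_mono[OF N_bounds(1), of 2] by (intro mult_right_mono) auto
  then have N4: "N\<^sup>2 \<le> N ^ 4 / g ^ 4" using g by (simp add: field_simps flip: power_add)
  have c: "2 * s * (2 * s + 2) \<ge> 0" using s by simp
  \<comment> \<open>As a quadratic form in (u^2, w^2), the bracket is (s + 2) ((4s + 3) u^4 - 6 u^2
    w^2 + 3 w^4). The factor 4s + 3 completes the square.\<close>
  have sq: "(4 * s + 3) * (?Q + (3 * s + 3) * N\<^sup>2) = (s + 2) * (((4 * s + 3) * u\<^sup>2 - 3 * w\<^sup>2)\<^sup>2 + 12 * s * (w\<^sup>2)\<^sup>2)"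
    unfolding Nuw by (simp add: algebra_simps power2_eq_square power4_eq_xxxx)
  have "0 \<le> (4 * s + 3) * (?Q + (3 * s + 3) * N\<^sup>2)"
    unfolding sq using s by simp
  then have "0 \<le> ?Q + (3 * s + 3) * N\<^sup>2" using s by (simp add: zero_le_mult_iff)
  moreover have "(3 * s + 3) * N\<^sup>2 \<le> (3 * s + 3) * (N ^ 4 / g ^ 4)" using N4 s by (intro mult_left_mono) auto
  ultimately have "- ((3 * s + 3) * (N ^ 4 / g ^ 4)) \<le> ?Q" by linarith
  from mult_left_mono[OF this c] 
  show "- 2 * s * (2 * s + 2) * (3 * s + 3) / g ^ 4 * N ^ 4 \<le> quartic s u w"
    unfolding quartic_def by (simp add: mult_ac)
  \<comment> \<open>The w^4 coefficient is (2s + 1)(2s + 3) - 3, so every coefficient of the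
    difference is nonnegative. Only N >= g^2 is used afterwards, which treats both directions
    alike.\<close>
  have e: "(2 * s + 1) * (2 * s + 3) * N\<^sup>2 - ?Q
      = (2 * ((2 * s + 1) * (2 * s + 3)) + 6 * (2 * s + 3)) * (u\<^sup>2 * w\<^sup>2) + (4 * s\<^sup>2 + 8 * s) * (w\<^sup>2)\<^sup>2"
    unfolding Nuw by (simp add: algebra_simps power2_eq_square power4_eq_xxxx)
  have "0 \<le> (2 * s + 1) * (2 * s + 3) * N\<^sup>2 - ?Q" unfolding e using s by simp
  moreover have "(2 * s + 1) * (2 * s + 3) * N\<^sup>2 \<le> (2 * s + 1) * (2 * s + 3) * (N ^ 4 / g ^ 4)"
    using N4 s by (intro mult_left_mono) auto
  ultimately have "?Q \<le> (2 * s + 1) * (2 * s + 3) * (N ^ 4 / g ^ 4)" by linarith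
  from mult_left_mono[OF this c] 
  show "quartic s u w \<le> (2 * s) * (2 * s + 1) * (2 * s + 2) * (2 * s + 3) / g ^ 4 * N ^ 4"
    unfolding quartic_def by (simp add: divide_inverse algebra_simps)
qed

lemma poly_bounds_y1: "- (s / g) * N ^ 1 \<le> - 2 * s * y" "- 2 * s * y \<le> s / g * N ^ 1"
proof -
  have "2 * s * \<bar>y\<bar> = s / g * (2 * g * \<bar>y\<bar>)" using g by simp
  also have "\<dots> \<le> s / g * N" using N_bounds(7) g s by (intro mult_left_mono) auto
  finally have "2 * s * \<bar>y\<bar> \<le> s / g * N" .
  moreover have "2 * s * y \<le> 2 * s * \<bar>y\<bar>" "- (2 * s * y) \<le> 2 * s * \<bar>y\<bar>" 
    using mult_left_mono[OF abs_ge_self[of y], of "2 * s"] mult_left_mono[OF abs_ge_minus_self[of y], of "2 * s"] s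
    by simp_all
  ultimately show "- (s / g) * N ^ 1 \<le> - 2 * s * y" "- 2 * s * y \<le> s / g * N ^ 1" by simp_all
qed

lemma poly_bounds_y2:
  "- 2 * s / g\<^sup>2 * N\<^sup>2 \<le> 2 * s * ((2 * s + 1) * y\<^sup>2 - x\<^sup>2)"
  "2 * s * ((2 * s + 1) * y\<^sup>2 - x\<^sup>2) \<le> 2 * s * (2 * s + 1) / (4 * g\<^sup>2) * N\<^sup>2"
proof -
  have c: "2 * s \<ge> 0" using s by simp
  have "g\<^sup>2 * x\<^sup>2 \<le> N * N" using N_bounds by (intro mult_mono) auto
  then have "x\<^sup>2 \<le> N\<^sup>2 / g\<^sup>2" using g by (simp add: field_simps power2_eq_square)
  moreover have "0 \<le> (2 * s + 1) * y\<^sup>2" using s by simp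
  ultimately have "- (N\<^sup>2 / g\<^sup>2) \<le> (2 * s + 1) * y\<^sup>2 - x\<^sup>2" by linarith
  from mult_left_mono[OF this c]
  show "- 2 * s / g\<^sup>2 * N\<^sup>2 \<le> 2 * s * ((2 * s + 1) * y\<^sup>2 - x\<^sup>2)" by simp
  have "(2 * g * \<bar>y\<bar>)\<^sup>2 \<le> N\<^sup>2" using N_bounds(7) g by (intro power_mono) auto
  then have "y\<^sup>2 \<le> N\<^sup>2 / (4 * g\<^sup>2)" using g by (simp add: field_simps power_mult_distrib)
  then have "(2 * s + 1) * y\<^sup>2 \<le> (2 * s + 1) * (N\<^sup>2 / (4 * g\<^sup>2))" using s by (intro mult_left_mono) auto
  then have "(2 * s + 1) * y\<^sup>2 - x\<^sup>2 \<le> (2 * s + 1) * (N\<^sup>2 / (4 * g\<^sup>2))" by (smt (verit) zero_le_power2)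
  from mult_left_mono[OF this c]
  show "2 * s * ((2 * s + 1) * y\<^sup>2 - x\<^sup>2) \<le> 2 * s * (2 * s + 1) / (4 * g\<^sup>2) * N\<^sup>2"
    by (simp only: times_divide_eq_left times_divide_eq_right mult.assoc)
qed

text \<open>The ratio |y| x^5 / N^3 is maximal at x^2 = 5 y^2, with value 25 sqrt 5 / 216. Rescaling
  y by sqrt 5 moves the extremal point to u = x.\<close>

lemma quintic_le_cube: "3 * \<bar>y\<bar> * x ^ 5 \<le> 25 * sqrt 5 / 72 * N ^ 3"
proof -
  define u where "u = sqrt 5 * \<bar>y\<bar>"
  have u: "u \<ge> 0" "u\<^sup>2 = 5 * y\<^sup>2" by (simp_all add: u_def power_mult_distrib)
  have x0: "x > 0" using x g by simp
  \<comment> \<open>Certificate for 216 u x^5 \<le> (5 x^2 + u^2)^3, with equality at u = x.\<close>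
  have "0 \<le> (u - x)\<^sup>2 * (u ^ 4 + 2 * u ^ 3 * x + 18 * u\<^sup>2 * x\<^sup>2 + 34 * u * x ^ 3 + 125 * x ^ 4)"
    using u(1) x0 by simp
  also have "\<dots> = (5 * x\<^sup>2 + u\<^sup>2) ^ 3 - 216 * u * x ^ 5"
    by (simp add: algebra_simps eval_nat_numeral)
  also have "(5 * x\<^sup>2 + u\<^sup>2) ^ 3 = 125 * N ^ 3"
    unfolding u(2) N by (simp add: algebra_simps eval_nat_numeral)
  finally have "sqrt 5 * (216 * u * x ^ 5) \<le> sqrt 5 * (125 * N ^ 3)" by simp
  moreover have "sqrt 5 * (216 * u * x ^ 5) = 1080 * (\<bar>y\<bar> * x ^ 5)" by (simp add: u_def)
  ultimately show ?thesis by simp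
qed

text \<open>The two entries of the maximum belong to the two signs of \<open>?q\<close>. If it is
  nonnegative, (2s + 1) |y|^3 dominates and 2 g |y| <= N gives the factor 1/8. Otherwise 3 x^2 |y|
  dominates, and with g^3 <= x^3 this is the quintic estimate.\<close>

lemma poly_bounds_y3:
  fixes M defines "M \<equiv> max (25 * sqrt 5 / 72) ((2 * s + 1) / 8)"
  shows "- ((2 * s) * (2 * s + 2) / g ^ 3 * M) * N ^ 3
     \<le> - (2 * s * (2 * s + 2)) * (y * ((2 * s + 1) * y\<^sup>2 - 3 * x\<^sup>2))" (is ?A)
  "- (2 * s * (2 * s + 2)) * (y * ((2 * s + 1) * y\<^sup>2 - 3 * x\<^sup>2))
     \<le> (2 * s) * (2 * s + 2) / g ^ 3 * M * N ^ 3" (is ?B)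
proof -
  let ?q = "(2 * s + 1) * y\<^sup>2 - 3 * x\<^sup>2"
  have c: "2 * s * (2 * s + 2) \<ge> 0" using s by simp
  have N3: "N ^ 3 \<ge> 0" using N_bounds(5) by simp
  have "g ^ 3 * (\<bar>y\<bar> * \<bar>?q\<bar>) \<le> M * N ^ 3"
  proof (cases "?q \<ge> 0")
    case True
    have "(2 * g * \<bar>y\<bar>) ^ 3 \<le> N ^ 3" using N_bounds(7) g by (intro power_mono) auto
    then have 1: "8 * (g ^ 3 * \<bar>y\<bar> ^ 3) \<le> N ^ 3" by (simp add: power_mult_distrib)
    have "g ^ 3 * (\<bar>y\<bar> * \<bar>?q\<bar>) \<le> g ^ 3 * (\<bar>y\<bar> * ((2 * s + 1) * \<bar>y\<bar>\<^sup>2))"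
      using True g by (intro mult_left_mono) auto
    also have "\<dots> = (2 * s + 1) / 8 * (8 * (g ^ 3 * \<bar>y\<bar> ^ 3))"
      by (simp add: power2_eq_square power3_eq_cube)
    also have "\<dots> \<le> (2 * s + 1) / 8 * N ^ 3" using 1 s by (intro mult_left_mono) auto
    also have "\<dots> \<le> M * N ^ 3" using N3 by (intro mult_right_mono) (auto simp: M_def)
    finally show ?thesis .
  next
    case False
    have "g ^ 3 * (\<bar>y\<bar> * \<bar>?q\<bar>) \<le> x ^ 3 * (\<bar>y\<bar> * (3 * x\<^sup>2))"
      using False x g s by (intro mult_mono power_mono) (auto intro: add_nonneg_nonneg)
    also have "\<dots> = 3 * \<bar>y\<bar> * x ^ 5" by (simp add: eval_nat_numeral)
    also have "\<dots> \<le> 25 * sqrt 5 / 72 * N ^ 3" by (rule quintic_le_cube)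
    also have "\<dots> \<le> M * N ^ 3" using N3 by (intro mult_right_mono) (auto simp: M_def)
    finally show ?thesis .
  qed
  then have "\<bar>y * ?q\<bar> \<le> M * N ^ 3 / g ^ 3" using g by (simp add: pos_le_divide_eq abs_mult mult_ac)
  then have "y * ?q \<le> M * N ^ 3 / g ^ 3" "- (y * ?q) \<le> M * N ^ 3 / g ^ 3" by linarith+
  from mult_left_mono[OF this(1) c] mult_left_mono[OF this(2) c] show ?A ?B
    by (simp_all add: mult_ac)
qed

end

text \<open>Each bound, even the zero one, is written as a constant times the kernel: in this linear
  form it passes through a positive functional.\<close>

lemma riesz_kernel_derivative_bounds:
  fixes g s :: real
  assumes w: "Re w \<ge> g" and g: "g > 0" and s: "s > 0"
  shows "- 2 * s / g * riesz_kernel s w \<le> pd [1] (riesz_kernel s) w"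
    "pd [1] (riesz_kernel s) w \<le> 0 * riesz_kernel s w"
    "- s / (4 * g\<^sup>2 * (s + 1)) * riesz_kernel s w \<le> pd [1, 1] (riesz_kernel s) w"
    "pd [1, 1] (riesz_kernel s) w \<le> 2 * s * (2 * s + 1) / g\<^sup>2 * riesz_kernel s w"
    "- 2 * s * (2 * s + 1) * (2 * s + 2) / g ^ 3 * riesz_kernel s w \<le> pd [1, 1, 1] (riesz_kernel s) w"
    "pd [1, 1, 1] (riesz_kernel s) w \<le> (2 * s) * (2 * s + 2) / (g ^ 3 * (s + 2)\<^sup>2) * riesz_kernel s w"
    "- 2 * s * (2 * s + 2) * (3 * s + 3) / g ^ 4 * riesz_kernel s w \<le> pd [1, 1, 1, 1] (riesz_kernel s) w"
    "pd [1, 1, 1, 1] (riesz_kernel s) w \<le> (2 * s) * (2 * s + 1) * (2 * s + 2) * (2 * s + 3) / g ^ 4 * riesz_kernel s w"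
    "- (s / g) * riesz_kernel s w \<le> pd [\<i>] (riesz_kernel s) w"
    "pd [\<i>] (riesz_kernel s) w \<le> s / g * riesz_kernel s w"
    "- 2 * s / g\<^sup>2 * riesz_kernel s w \<le> pd [\<i>, \<i>] (riesz_kernel s) w"
    "pd [\<i>, \<i>] (riesz_kernel s) w \<le> 2 * s * (2 * s + 1) / (4 * g\<^sup>2) * riesz_kernel s w"
    "- ((2 * s) * (2 * s + 2) / g ^ 3 * max (25 * sqrt 5 / 72) ((2 * s + 1) / 8)) * riesz_kernel s w \<le> pd [\<i>, \<i>, \<i>] (riesz_kernel s) w"
    "pd [\<i>, \<i>, \<i>] (riesz_kernel s) w \<le> (2 * s) * (2 * s + 2) / g ^ 3 * max (25 * sqrt 5 / 72) ((2 * s + 1) / 8) * riesz_kernel s w"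
    "- 2 * s * (2 * s + 2) * (3 * s + 3) / g ^ 4 * riesz_kernel s w \<le> pd [\<i>, \<i>, \<i>, \<i>] (riesz_kernel s) w"
    "pd [\<i>, \<i>, \<i>, \<i>] (riesz_kernel s) w \<le> (2 * s) * (2 * s + 1) * (2 * s + 2) * (2 * s + 3) / g ^ 4 * riesz_kernel s w"
proof -
  have p: "Re w > 0" using w g by simp
  note facts = w g s nsq_def[of w]
  note pd = pd_riesz_kernel_1[OF p] pd_riesz_kernel_11[OF p] pd_riesz_kernel_111[OF p] pd_riesz_kernel_1111[OF p]
    pd_riesz_kernel_i[OF p] pd_riesz_kernel_ii[OF p] pd_riesz_kernel_iii[OF p] pd_riesz_kernel_iiii[OF p]
  note kb = kernel_bounds[OF p]
  show "- 2 * s / g * riesz_kernel s w \<le> pd [1] (riesz_kernel s) w"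
    "pd [1] (riesz_kernel s) w \<le> 0 * riesz_kernel s w"
    unfolding pd by (rule kb poly_bounds_x1[OF facts])+
  show "- s / (4 * g\<^sup>2 * (s + 1)) * riesz_kernel s w \<le> pd [1, 1] (riesz_kernel s) w"
    "pd [1, 1] (riesz_kernel s) w \<le> 2 * s * (2 * s + 1) / g\<^sup>2 * riesz_kernel s w"
    unfolding pd by (rule kb poly_bounds_x2[OF facts])+
  show "- 2 * s * (2 * s + 1) * (2 * s + 2) / g ^ 3 * riesz_kernel s w \<le> pd [1, 1, 1] (riesz_kernel s) w"
    "pd [1, 1, 1] (riesz_kernel s) w \<le> (2 * s) * (2 * s + 2) / (g ^ 3 * (s + 2)\<^sup>2) * riesz_kernel s w"
    unfolding pd by (rule kb poly_bounds_x3[OF facts])+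
  show "- 2 * s * (2 * s + 2) * (3 * s + 3) / g ^ 4 * riesz_kernel s w \<le> pd [1, 1, 1, 1] (riesz_kernel s) w"
    "pd [1, 1, 1, 1] (riesz_kernel s) w \<le> (2 * s) * (2 * s + 1) * (2 * s + 2) * (2 * s + 3) / g ^ 4 * riesz_kernel s w"
    unfolding pd by (rule kb poly_bounds_quartic[OF facts] disjI1 conjI refl)+
  show "- (s / g) * riesz_kernel s w \<le> pd [\<i>] (riesz_kernel s) w"
    "pd [\<i>] (riesz_kernel s) w \<le> s / g * riesz_kernel s w"
    unfolding pd by (rule kb poly_bounds_y1[OF facts])+
  show "- 2 * s / g\<^sup>2 * riesz_kernel s w \<le> pd [\<i>, \<i>] (riesz_kernel s) w"
    "pd [\<i>, \<i>] (riesz_kernel s) w \<le> 2 * s * (2 * s + 1) / (4 * g\<^sup>2) * riesz_kernel s w"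
    unfolding pd by (rule kb poly_bounds_y2[OF facts])+
  show "- ((2 * s) * (2 * s + 2) / g ^ 3 * max (25 * sqrt 5 / 72) ((2 * s + 1) / 8)) * riesz_kernel s w \<le> pd [\<i>, \<i>, \<i>] (riesz_kernel s) w"
    "pd [\<i>, \<i>, \<i>] (riesz_kernel s) w \<le> (2 * s) * (2 * s + 2) / g ^ 3 * max (25 * sqrt 5 / 72) ((2 * s + 1) / 8) * riesz_kernel s w"
    unfolding pd by (rule kb poly_bounds_y3[OF facts])+
  show "- 2 * s * (2 * s + 2) * (3 * s + 3) / g ^ 4 * riesz_kernel s w \<le> pd [\<i>, \<i>, \<i>, \<i>] (riesz_kernel s) w"
    "pd [\<i>, \<i>, \<i>, \<i>] (riesz_kernel s) w \<le> (2 * s) * (2 * s + 1) * (2 * s + 2) * (2 * s + 3) / g ^ 4 * riesz_kernel s w"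
    unfolding pd by (rule kb poly_bounds_quartic[OF facts] disjI2 conjI refl)+
qed

section \<open>The eigenfunctional of the dual operator\<close>

text \<open>A two-sided Fekete argument: estimating l (m n) as m blocks of length n and as n blocks
  of length m puts every (l n - d) / n below every (l m + d) / m. Any number separating the two
  families serves as r; the supremum of the lower one is taken.\<close>

lemma almost_additive_growth:
  fixes l :: "nat \<Rightarrow> real"
  assumes l: "\<And>m n. \<bar>l (m + n) - l m - l n\<bar> \<le> d"
  shows "\<exists>r. \<forall>n. \<bar>l n - real n * r\<bar> \<le> d"
proof -
  have up: "l (k * n) \<le> real k * (l n + d) - d" if "k \<ge> 1" for k n
    using that
  proof (induction k rule: dec_induct)
    case (step k)
    have "l (Suc k * n) \<le> l n + l (k * n) + d" using l[of n "k * n"] by (simp add: abs_le_iff)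
    with step show ?case by (simp add: algebra_simps)
  qed simp
  have lo: "real k * (l n - d) + d \<le> l (k * n)" if "k \<ge> 1" for k n
    using that
  proof (induction k rule: dec_induct)
    case (step k)
    have "l n + l (k * n) - d \<le> l (Suc k * n)" using l[of n "k * n"] by (simp add: abs_le_iff)
    with step show ?case by (simp add: algebra_simps)
  qed simp
  have d: "d \<ge> 0" using l[of 0 0] by linarith
  have le: "(l n - d) / real n \<le> (l m + d) / real m" if "n \<ge> 1" "m \<ge> 1" for m n
  proof -
    have "real m * (l n - d) + d \<le> real n * (l m + d) - d"
      using lo[OF that(2), of n] up[OF that(1), of m] by (simp add: mult.commute)
    then have "real m * (l n - d) \<le> real n * (l m + d)" using d by linarith
    then show ?thesis using that by (simp add: field_simps)
  qed
  define r where "r = (SUP n\<in>{1..}. (l n - d) / real n)"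
  have above: "bdd_above ((\<lambda>n. (l n - d) / real n) ` {1..})"
    using le[of _ 1] by (intro bdd_aboveI[of _ "(l 1 + d) / real 1"]) auto
  have "\<bar>l n - real n * r\<bar> \<le> d" for n
  proof (cases "n \<ge> 1")
    case True
    have "(l n - d) / real n \<le> r" unfolding r_def using True above by (intro cSUP_upper) auto
    moreover have "r \<le> (l n + d) / real n" unfolding r_def using True le by (intro cSUP_least) auto
    ultimately show ?thesis using True by (simp add: field_simps abs_le_iff)
  next
    case False
    then have "n = 0" by simp
    then show ?thesis using l[of 0 0] by simp
  qed
  then show ?thesis by blast
qed

text \<open>Provides the normalisation of the orbit: a n / r^n stays between 1 / D and D, which is
  stronger than convergence of the n-th roots.\<close>

lemma almost_multiplicative_growth:
  fixes a :: "nat \<Rightarrow> real"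
  assumes pos: "\<And>n. a n > 0" and D: "D > 0"
    and le: "\<And>m n. a (m + n) \<le> D * a m * a n" and ge: "\<And>m n. a m * a n \<le> D * a (m + n)"
  shows "\<exists>r>0. \<forall>n. a n \<le> D * r ^ n \<and> r ^ n \<le> D * a n"
proof -
  have "\<bar>ln (a (m + n)) - ln (a m) - ln (a n)\<bar> \<le> ln D" for m n
  proof -
    have "ln (a (m + n)) \<le> ln (D * a m * a n)" using le pos D by simp
    moreover have "ln (a m * a n) \<le> ln (D * a (m + n))" using ge pos D by simp
    ultimately show ?thesis using pos D by (simp add: ln_mult abs_le_iff less_imp_neq[symmetric])
  qed
  then obtain r where r: "\<And>n. \<bar>ln (a n) - real n * r\<bar> \<le> ln D"
    using almost_additive_growth[of "\<lambda>n. ln (a n)"] by blast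
  have "a n \<le> D * exp r ^ n \<and> exp r ^ n \<le> D * a n" for n
  proof -
    have "exp (ln (a n)) \<le> exp (ln D + real n * r)" "exp (real n * r) \<le> exp (ln D + ln (a n))"
      using r[of n] by (simp_all add: abs_le_iff)
    then show ?thesis using pos[of n] D by (simp add: exp_add exp_of_nat_mult)
  qed
  then show ?thesis using exp_gt_zero by blast
qed

section \<open>The dual operator and its Harnack inequality\<close>

locale mobius_system =
  fixes B :: "complex set" and g s :: real
  assumes fin: "finite B" and ne: "B \<noteq> {}" and g1: "g \<ge> 1"
    and ReB: "\<And>\<beta>. \<beta> \<in> B \<Longrightarrow> Re \<beta> \<ge> g" and s0: "s > 0"
begin

text \<open>Since \<gamma> >= 1, points b with Re b >= \<gamma> satisfy |1 / b| <= 1. Adding 1 to a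
  bound for the digits therefore makes \<open>K\<close> invariant under all maps b -> \<beta> +
  1/b.\<close>

definition R :: real where "R = (\<Sum>\<beta>\<in>B. cmod \<beta>) + 1"

definition K :: "complex set" where "K = {b. Re b \<ge> g \<and> cmod b \<le> R}"

definition T :: "(complex \<Rightarrow> real) \<Rightarrow> complex \<Rightarrow> real" where
  "T f b = (\<Sum>\<beta>\<in>B. riesz_kernel s b * f (\<beta> + inverse b))"

definition b0 :: complex where "b0 = (SOME b. b \<in> B)"

definition bdd_on_K :: "(complex \<Rightarrow> real) \<Rightarrow> bool" where
  "bdd_on_K f \<longleftrightarrow> (\<exists>M. \<forall>b\<in>K. \<bar>f b\<bar> \<le> M)"

lemma R1: "R \<ge> 1" by (simp add: R_def sum_nonneg)

lemma b0_in: "b0 \<in> B" unfolding b0_def using ne some_in_eq by blast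

lemma B_sub_K: "\<beta> \<in> B \<Longrightarrow> \<beta> \<in> K"
  using ReB member_le_sum[of \<beta> B cmod] fin by (auto simp: K_def R_def)

lemma b0_K: "b0 \<in> K" using B_sub_K b0_in by blast

lemma K_D: "b \<in> K \<Longrightarrow> Re b \<ge> g" "b \<in> K \<Longrightarrow> Re b > 0" "b \<in> K \<Longrightarrow> Re b \<ge> 1" "b \<in> K \<Longrightarrow> cmod b \<le> R"
    "b \<in> K \<Longrightarrow> cmod b \<ge> 1" "b \<in> K \<Longrightarrow> b \<noteq> 0"
  using g1 complex_Re_le_cmod[of b] by (auto simp: K_def)

lemma Re_inverse_nonneg: "Re z \<ge> 0 \<Longrightarrow> Re (inverse z) \<ge> 0"
  by simp

lemma K_step: "b \<in> K \<Longrightarrow> \<beta> \<in> B \<Longrightarrow> \<beta> + inverse b \<in> K"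
proof -
  assume b: "b \<in> K" and \<beta>: "\<beta> \<in> B"
  have "cmod \<beta> \<le> (\<Sum>\<beta>\<in>B. cmod \<beta>)" using member_le_sum[of \<beta> B cmod] fin \<beta> by auto
  moreover have "cmod (inverse b) \<le> 1" using K_D(5)[OF b] by (simp add: norm_inverse inverse_le_1_iff)
  ultimately have "cmod (\<beta> + inverse b) \<le> R"
    unfolding R_def by (intro norm_triangle_le) linarith
  moreover have "Re (\<beta> + inverse b) \<ge> g"
    using ReB[OF \<beta>] Re_inverse_nonneg[of b] K_D(2)[OF b] by (simp del: inverse_complex.sel)
  ultimately show ?thesis by (simp add: K_def)
qed

lemma T_mono: "(\<And>b. b \<in> K \<Longrightarrow> f b \<le> h b) \<Longrightarrow> b \<in> K \<Longrightarrow> T f b \<le> T h b"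
  unfolding T_def using K_step K_D(2) by (intro sum_mono mult_left_mono) (auto simp: riesz_kernel_def)

lemma Tn_mono: "(\<And>b. b \<in> K \<Longrightarrow> f b \<le> h b) \<Longrightarrow> b \<in> K \<Longrightarrow> (T ^^ n) f b \<le> (T ^^ n) h b"
  by (induction n arbitrary: b) (auto intro: T_mono)

lemma T_lin: "T (\<lambda>b. c * f b + d * h b) = (\<lambda>b. c * T f b + d * T h b)"
  by (rule ext) (simp add: T_def sum.distrib sum_distrib_left algebra_simps)

lemma Tn_lin: "(T ^^ n) (\<lambda>b. c * f b + d * h b) = (\<lambda>b. c * (T ^^ n) f b + d * (T ^^ n) h b)"
  by (induction n) (simp_all add: T_lin)

lemma Tn_scale: "(T ^^ n) (\<lambda>b. c * f b) = (\<lambda>b. c * (T ^^ n) f b)"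
  using Tn_lin[of n c f 0 f] by simp

lemma Tn_zero: "(T ^^ n) (\<lambda>b. 0) = (\<lambda>b. 0)"
  using Tn_scale[of n 0 "\<lambda>b. 0"] by simp

lemma Tn_sum: "finite A \<Longrightarrow> (T ^^ n) (\<lambda>b. \<Sum>i\<in>A. c i * f i b) = (\<lambda>b. \<Sum>i\<in>A. c i * (T ^^ n) (f i) b)"
proof (induction A rule: finite_induct)
  case (insert i A)
  then show ?case using Tn_lin[of n "c i" "f i" 1 "\<lambda>b. \<Sum>i\<in>A. c i * f i b"] by simp
qed (simp add: Tn_zero)

lemma Tn_abs:
  assumes "\<And>b. b \<in> K \<Longrightarrow> \<bar>f b\<bar> \<le> M" "b \<in> K"
  shows "\<bar>(T ^^ n) f b\<bar> \<le> M * (T ^^ n) (\<lambda>_. 1) b"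
proof -
  have "(T ^^ n) f b \<le> (T ^^ n) (\<lambda>b. M * 1) b" "(T ^^ n) (\<lambda>b. (- M) * 1) b \<le> (T ^^ n) f b"
    using assms by (intro Tn_mono; force simp: abs_le_iff)+
  then show ?thesis unfolding Tn_scale by (simp add: abs_le_iff)
qed

text \<open>Term by term both sides equal |b (z + \<beta>) + 1|^(-2s): this number can be factored
  through b or through z + \<beta>, and \<open>nsq\<close> is multiplicative.\<close>

lemma intertwine:
  assumes "Re z \<ge> 0" "b \<in> K"
  shows "T (\<lambda>b. riesz_kernel s (z + b)) b = (\<Sum>\<beta>\<in>B. riesz_kernel s (z + \<beta>) * riesz_kernel s (inverse (z + \<beta>) + b))"
  unfolding T_def
proof (intro sum.cong refl)
  fix \<beta> assume \<beta>: "\<beta> \<in> B"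
  have z: "z + \<beta> \<noteq> 0" using assms ReB[OF \<beta>] g1 by (auto simp: complex_eq_iff)
  have b: "b \<noteq> 0" using K_D(6) assms by blast
  have eq: "b * (z + (\<beta> + inverse b)) = (z + \<beta>) * (inverse (z + \<beta>) + b)"
    using z b by (simp add: field_simps)
  have "riesz_kernel s b * riesz_kernel s (z + (\<beta> + inverse b)) = riesz_kernel s (b * (z + (\<beta> + inverse b)))"
    by (simp add: riesz_kernel_def nsq_mult powr_mult)
  also have "\<dots> = riesz_kernel s (z + \<beta>) * riesz_kernel s (inverse (z + \<beta>) + b)"
    unfolding eq by (simp add: riesz_kernel_def nsq_mult powr_mult)
  finally show "riesz_kernel s b * riesz_kernel s (z + (\<beta> + inverse b)) = \<dots>" .
qed

lemma T_cong: "(\<And>b. b \<in> K \<Longrightarrow> f b = h b) \<Longrightarrow> b \<in> K \<Longrightarrow> (T ^^ n) f b = (T ^^ n) h b"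
  using Tn_mono[of f h b n] Tn_mono[of h f b n] by (simp add: order_antisym)

text \<open>Turns one application of the operator in b into a change of the parameter z, so that
  iterates can be estimated by induction over z with b fixed.\<close>

lemma Tn_kernel_Suc:
  assumes "Re z \<ge> 0" "b \<in> K"
  shows "(T ^^ Suc n) (\<lambda>b. riesz_kernel s (z + b)) b
     = (\<Sum>\<beta>\<in>B. riesz_kernel s (z + \<beta>) * (T ^^ n) (\<lambda>b. riesz_kernel s (inverse (z + \<beta>) + b)) b)"
proof -
  have "(T ^^ Suc n) (\<lambda>b. riesz_kernel s (z + b)) b = (T ^^ n) (T (\<lambda>b. riesz_kernel s (z + b))) b"
    by (simp add: funpow_swap1)
  also have "\<dots> = (T ^^ n) (\<lambda>b. \<Sum>\<beta>\<in>B. riesz_kernel s (z + \<beta>) * riesz_kernel s (inverse (z + \<beta>) + b)) b"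
    using intertwine[OF assms(1)] assms(2) by (intro T_cong) auto
  finally show ?thesis unfolding Tn_sum[OF fin] .
qed

text \<open>Harnack constant of a single kernel: two points of \<open>K\<close> are at distance at
  most 2 R and |z + b| >= 1, so |z + b'| <= (1 + 2 R) |z + b|.\<close>

definition C :: real where "C = (1 + 2 * R) powr (2 * s)"

lemma C1: "C \<ge> 1"
  unfolding C_def using R1 s0 by (intro ge_one_powr_ge_zero) auto

lemma riesz_kernel_cmod: "riesz_kernel s z = cmod z powr (- 2 * s)"
  by (cases "z = 0") (simp_all add: riesz_kernel_def nsq_eq_cmod powr_powr flip: powr_numeral)

lemma riesz_kernel_harnack:
  assumes "Re z \<ge> 0" "b \<in> K" "b' \<in> K"
  shows "riesz_kernel s (z + b) \<le> C * riesz_kernel s (z + b')"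
proof -
  have 1: "cmod (z + b) \<ge> 1" using assms K_D(3) complex_Re_le_cmod[of "z + b"] by fastforce
  have 2: "cmod (z + b') \<ge> 1" using assms K_D(3) complex_Re_le_cmod[of "z + b'"] by fastforce
  have "cmod (z + b') \<le> cmod (z + b) + (cmod b' + cmod b)"
    using norm_triangle_ineq[of "z + b" "b' - b"] norm_triangle_ineq4[of b' b] by simp
  also have "\<dots> \<le> cmod (z + b) + 2 * R" using K_D(4)[OF assms(2)] K_D(4)[OF assms(3)] by simp
  also have "\<dots> \<le> (1 + 2 * R) * cmod (z + b)" using 1 R1 by (simp add: algebra_simps mult_le_cancel_left1)
  finally have "((1 + 2 * R) * cmod (z + b)) powr (- (2 * s)) \<le> cmod (z + b') powr (- (2 * s))"
    using 2 s0 by (intro powr_mono2') auto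
  then have "(1 + 2 * R) powr (- (2 * s)) * cmod (z + b) powr (- (2 * s)) \<le> cmod (z + b') powr (- (2 * s))"
    using R1 by (simp add: powr_mult)
  then have "C * ((1 + 2 * R) powr (- (2 * s)) * cmod (z + b) powr (- (2 * s))) \<le> C * cmod (z + b') powr (- (2 * s))"
    using C1 by (intro mult_left_mono) auto
  moreover have "C * ((1 + 2 * R) powr (- (2 * s)) * y) = y" for y
    using R1 by (simp add: C_def powr_minus)
  ultimately show ?thesis by (simp add: riesz_kernel_cmod)
qed

text \<open>The constant does not deteriorate with n: the iterate is a nonnegative combination of
  earlier iterates at new parameters in the half plane, each of which satisfies the same
  inequality.\<close>

lemma Tn_kernel_harnack:
  assumes "Re z \<ge> 0" "b \<in> K" "b' \<in> K"
  shows "(T ^^ n) (\<lambda>b. riesz_kernel s (z + b)) b \<le> C * (T ^^ n) (\<lambda>b. riesz_kernel s (z + b)) b'"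
  using assms(1)
proof (induction n arbitrary: z)
  case 0
  then show ?case using riesz_kernel_harnack assms by simp
next
  case (Suc n)
  have "Re (inverse (z + \<beta>)) \<ge> 0" if "\<beta> \<in> B" for \<beta>
    using Suc.prems ReB[OF that] g1 by (intro Re_inverse_nonneg) simp
  then show ?case
    unfolding Tn_kernel_Suc[OF Suc.prems assms(2)] Tn_kernel_Suc[OF Suc.prems assms(3)] sum_distrib_left
    using Suc.IH by (intro sum_mono, subst mult.left_commute, intro mult_left_mono) (auto simp: riesz_kernel_def simp del: inverse_complex.sel)
qed

definition E :: real where "E = R powr (2 * s) * C"

lemma E1: "E \<ge> 1"
proof -
  have "R powr (2 * s) \<ge> 1" using R1 s0 by (intro ge_one_powr_ge_zero) auto
  then have "1 * 1 \<le> R powr (2 * s) * C" using C1 by (intro mult_mono) auto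
  then show ?thesis by (simp add: E_def)
qed

text \<open>On \<open>K\<close> the constant 1 lies between the kernel at z = 0 and R^(2s) times it.
  This carries the Harnack inequality over at the price of the extra factor in
  \<open>E\<close>.\<close>

lemma Tn_one_harnack:
  assumes "b \<in> K" "b' \<in> K"
  shows "(T ^^ n) (\<lambda>_. 1) b \<le> E * (T ^^ n) (\<lambda>_. 1) b'"
proof -
  let ?k = "\<lambda>b. riesz_kernel s (0 + b)" and ?r = "R powr (2 * s)"
  have r: "?r \<ge> 0" by simp
  have lo: "1 \<le> ?r * ?k b" if "b \<in> K" for b
  proof -
    have "1 = ?r * R powr (- (2 * s))" using R1 by (simp add: powr_minus)
    also have "R powr (- (2 * s)) \<le> cmod b powr (- (2 * s))"
      using K_D(4,5)[OF that] s0 by (intro powr_mono2') auto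
    finally show ?thesis by (simp add: riesz_kernel_cmod mult_left_mono)
  qed
  have hi: "?k b \<le> 1" if "b \<in> K" for b
    using powr_mono2'[of "- (2 * s)" 1 "cmod b"] K_D(5)[OF that] s0 by (simp add: riesz_kernel_cmod)
  have "(T ^^ n) (\<lambda>_. 1) b \<le> (T ^^ n) (\<lambda>b. ?r * ?k b) b" by (rule Tn_mono[OF lo assms(1)])
  also have "\<dots> = ?r * (T ^^ n) ?k b" by (simp add: Tn_scale)
  also have "\<dots> \<le> ?r * (C * (T ^^ n) ?k b')"
    using Tn_kernel_harnack[of 0 b b' n] assms by (intro mult_left_mono) auto
  also have "\<dots> \<le> ?r * (C * (T ^^ n) (\<lambda>_. 1) b')"
    using C1 by (intro mult_left_mono Tn_mono hi assms) auto
  finally show ?thesis by (simp add: E_def mult.assoc)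
qed

definition a :: "nat \<Rightarrow> real" where "a n = (T ^^ n) (\<lambda>_. 1) b0"

lemma Tn_one_pos: "b \<in> K \<Longrightarrow> (T ^^ n) (\<lambda>_. 1) b > 0"
proof (induction n arbitrary: b)
  case (Suc n)
  then show ?case using fin ne K_step K_D(2)
    by (auto simp: T_def intro!: sum_pos mult_pos_pos riesz_kernel_pos)
qed simp

text \<open>By the Harnack inequality the inner iterate is, up to the factor \<open>E\<close>, the
  constant \<open>a n\<close> on all of \<open>K\<close>; monotonicity and scaling of the outer
  iterate do the rest.\<close>

lemma a_mult: "a (m + n) \<le> E * a m * a n" "a m * a n \<le> E * a (m + n)"
proof -
  have e: "a (m + n) = (T ^^ m) ((T ^^ n) (\<lambda>_. 1)) b0" by (simp add: a_def funpow_add)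
  have s: "(T ^^ m) (\<lambda>b. c * 1) b0 = c * a m" for c by (simp only: a_def Tn_scale)
  have "a (m + n) \<le> (T ^^ m) (\<lambda>b. (E * a n) * 1) b0"
    unfolding e using Tn_one_harnack b0_K by (intro Tn_mono) (auto simp: a_def)
  then show "a (m + n) \<le> E * a m * a n" unfolding s by (simp add: mult_ac)
  have "(T ^^ m) (\<lambda>b. a n * 1) b0 \<le> (T ^^ m) (\<lambda>b. E * (T ^^ n) (\<lambda>_. 1) b) b0"
    using Tn_one_harnack b0_K by (intro Tn_mono) (auto simp: a_def)
  also have "\<dots> = E * a (m + n)" unfolding e Tn_scale ..
  finally show "a m * a n \<le> E * a (m + n)" unfolding s by (simp add: mult_ac)
qed

lemma growth: "\<exists>r>0. \<forall>n. a n \<le> E * r ^ n \<and> r ^ n \<le> E * a n"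
  using almost_multiplicative_growth[of a E] a_mult Tn_one_pos[OF b0_K] E1 by (auto simp: a_def)

lemma bdd_lin: "bdd_on_K f \<Longrightarrow> bdd_on_K h \<Longrightarrow> bdd_on_K (\<lambda>b. c * f b + d * h b)"
proof -
  assume "bdd_on_K f" "bdd_on_K h"
  then obtain M N where M: "\<And>b. b \<in> K \<Longrightarrow> \<bar>f b\<bar> \<le> M" and N: "\<And>b. b \<in> K \<Longrightarrow> \<bar>h b\<bar> \<le> N"
    unfolding bdd_on_K_def by blast
  have "\<bar>c * f b + d * h b\<bar> \<le> \<bar>c\<bar> * M + \<bar>d\<bar> * N" if "b \<in> K" for b
    using abs_triangle_ineq[of "c * f b" "d * h b"] mult_left_mono[OF M[OF that], of "\<bar>c\<bar>"]
      mult_left_mono[OF N[OF that], of "\<bar>d\<bar>"] by (simp add: abs_mult)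
  then show ?thesis unfolding bdd_on_K_def by blast
qed

lemma bdd_T: "bdd_on_K f \<Longrightarrow> bdd_on_K (T f)"
proof -
  assume "bdd_on_K f"
  then obtain M where M: "\<And>b. b \<in> K \<Longrightarrow> \<bar>f b\<bar> \<le> M" unfolding bdd_on_K_def by blast
  then have M0: "M \<ge> 0" using b0_K by (meson abs_ge_zero order_trans)
  have "\<bar>T f b\<bar> \<le> M * (E * a 1)" if "b \<in> K" for b
  proof -
    have "\<bar>(T ^^ 1) f b\<bar> \<le> M * (T ^^ 1) (\<lambda>_. 1) b" by (rule Tn_abs[OF M that])
    also have "\<dots> \<le> M * (E * a 1)"
      unfolding a_def by (intro mult_left_mono Tn_one_harnack that b0_K M0)
    finally show ?thesis by simp
  qed
  then show ?thesis unfolding bdd_on_K_def by blast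
qed

end

section \<open>Construction of the eigenfunctional\<close>

text \<open>L plays the part of an eigenmeasure on \<open>K\<close>, but as a finitely additive
  mean: its arguments are arbitrary functions bounded on \<open>K\<close>.\<close>

locale mobius_eigen = mobius_system +
  fixes L :: "(complex \<Rightarrow> real) \<Rightarrow> real" and r :: real
  assumes L1: "L (\<lambda>_. 1) > 0"
    and Llin: "\<And>f h c d. bdd_on_K f \<Longrightarrow> bdd_on_K h \<Longrightarrow> L (\<lambda>b. c * f b + d * h b) = c * L f + d * L h"
    and Lmono: "\<And>f h. bdd_on_K f \<Longrightarrow> bdd_on_K h \<Longrightarrow> (\<And>b. b \<in> K \<Longrightarrow> f b \<le> h b) \<Longrightarrow> L f \<le> L h"
    and Leig: "\<And>f. bdd_on_K f \<Longrightarrow> L (T f) = r * L f"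

text \<open>A limit point of the averaged orbit of the point mass at \<open>b0\<close> replaces the eigenmeasure of
  the dual operator. It is taken in the product topology over all test functions, so that
  Tychonoff's theorem provides it.\<close>

lemma (in mobius_system) mobius_eigen_exists: "\<exists>L r. mobius_eigen B g s L r"
proof -
  obtain r where r: "r > 0" "\<And>n. a n \<le> E * r ^ n" "\<And>n. r ^ n \<le> E * a n" using growth by blast
  define u where "u f n = (T ^^ n) f b0 / r ^ n" for f n
  have u_lin: "u (\<lambda>b. c * f b + d * h b) n = c * u f n + d * u h n" for c d f h n
    unfolding u_def Tn_lin by (simp add: add_divide_distrib)
  have u_mono: "u f n \<le> u h n" if "\<And>b. b \<in> K \<Longrightarrow> f b \<le> h b" for f h n
    unfolding u_def using r(1) Tn_mono[OF that b0_K] by (simp add: divide_right_mono)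
  have u_T: "u (T f) n = r * u f (Suc n)" for f n
    unfolding u_def using r(1) by (simp add: funpow_swap1)
  have u_bd: "\<bar>u f n\<bar> \<le> M * E" if "\<And>b. b \<in> K \<Longrightarrow> \<bar>f b\<bar> \<le> M" for f n M
  proof -
    have M0: "M \<ge> 0" using that[OF b0_K] by linarith
    have "\<bar>(T ^^ n) f b0\<bar> \<le> M * a n" unfolding a_def by (rule Tn_abs[OF that b0_K])
    also have "\<dots> \<le> M * (E * r ^ n)" using r(2) M0 by (intro mult_left_mono)
    finally show ?thesis using r(1) by (simp add: u_def field_simps)
  qed
  \<comment> \<open>This lower half of the growth estimate keeps the limit functional from vanishing
    on constants.\<close>
  have u_1: "1 / E \<le> u (\<lambda>_. 1) n" for n
    using r(3)[of n] r(1) E1 by (simp add: u_def a_def field_simps)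
  \<comment> \<open>Cesaro means of the normalised orbit. The value 0 on functions unbounded on
    \<open>K\<close> puts every mean into a product of compact sets, intervals or the singleton of
    0.\<close>
  define A where "A N f = (if bdd_on_K f then (\<Sum>n<Suc N. u f n) / Suc N else 0)" for N f
  define M where "M f = (SOME M. \<forall>b\<in>K. \<bar>f b\<bar> \<le> M)" for f :: "complex \<Rightarrow> real"
  have M: "\<bar>f b\<bar> \<le> M f" if "bdd_on_K f" "b \<in> K" for f b
    using someI_ex[of "\<lambda>M. \<forall>b\<in>K. \<bar>f b\<bar> \<le> M"] that unfolding bdd_on_K_def M_def by blast
  have u_M: "\<bar>u f n\<bar> \<le> M f * E" if "bdd_on_K f" for f n
    by (rule u_bd[OF M[OF that]])
  define S where "S = (PiE UNIV (\<lambda>f. if bdd_on_K f then {- (M f * E)..M f * E} else {0}))"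
  have AS: "A N \<in> S" for N
  proof -
    have "\<bar>(\<Sum>n<Suc N. u f n)\<bar> \<le> real (Suc N) * (M f * E)" if "bdd_on_K f" for f
      using sum_norm_bound[of "{..<Suc N}" "u f" "M f * E"] u_M[OF that] by simp
    then have "\<bar>A N f\<bar> \<le> M f * E" if "bdd_on_K f" for f
      using that by (simp add: A_def field_simps del: sum.lessThan_Suc)
    then have "- (M f * E) \<le> A N f \<and> A N f \<le> M f * E" if "bdd_on_K f" for f
      using that by (meson abs_le_D1 abs_le_D2 minus_le_iff)
    moreover have "A N f = 0" if "\<not> bdd_on_K f" for f using that by (simp add: A_def)
    ultimately show ?thesis by (simp add: S_def PiE_UNIV_domain)
  qed
  have "compactin (product_topology (\<lambda>_. euclidean) UNIV) S"
    unfolding S_def by (subst compactin_PiE) auto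
  then have "compact S" by (simp add: euclidean_product_topology)
  \<comment> \<open>The product runs over uncountably many test functions, so a cluster point is
    taken instead of the limit of a subsequence. The filter G below plays the role of the
    subsequence.\<close>
  then obtain L where L: "inf (nhds L) (filtermap A sequentially) \<noteq> bot"
    unfolding compact_filter using AS 
    by (metis (no_types, lifting) eventually_filtermap eventually_sequentiallyI filtermap_bot_iff sequentially_bot)
  define G where "G = inf (nhds L) (filtermap A sequentially)"
  have Gbot: "G \<noteq> bot" using L by (simp add: G_def)
  have GleL: "G \<le> nhds L" and GleA: "G \<le> filtermap A sequentially" by (simp_all add: G_def)
  have lim: "((\<lambda>F. F f) \<longlongrightarrow> L f) G" for f
  proof -
    have "((\<lambda>F. F f) \<longlongrightarrow> L f) (nhds L)"
    proof (rule topological_tendstoI)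
      fix U :: "real set" assume "open U" "L f \<in> U"
      then have "open ((\<lambda>F. F f) -` U)" "L \<in> (\<lambda>F. F f) -` U"
        by (auto intro: open_vimage)
      then show "\<forall>\<^sub>F F in nhds L. F f \<in> U"
        unfolding eventually_nhds by (intro exI[of _ "(\<lambda>F. F f) -` U"]) simp
    qed
    then show ?thesis by (rule tendsto_mono[OF GleL])
  qed
  have evG: "eventually P G" if "eventually (\<lambda>N. P (A N)) sequentially" for P
    by (rule filter_leD[OF GleA]) (use that in \<open>simp add: eventually_filtermap\<close>)
  have lin: "L (\<lambda>b. c * f b + d * h b) = c * L f + d * L h" if "bdd_on_K f" "bdd_on_K h" for f h c d
  proof (rule tendsto_unique[OF Gbot lim])
    have "A N (\<lambda>b. c * f b + d * h b) = c * A N f + d * A N h" for N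
      using that bdd_lin[OF that] 
      by (simp add: A_def u_lin sum.distrib add_divide_distrib flip: sum_distrib_left del: sum.lessThan_Suc)
    then have "eventually (\<lambda>F. c * F f + d * F h = F (\<lambda>b. c * f b + d * h b)) G" by (intro evG) simp
    moreover have "((\<lambda>F. c * F f + d * F h) \<longlongrightarrow> c * L f + d * L h) G" by (intro tendsto_intros lim)
    ultimately show "((\<lambda>F. F (\<lambda>b. c * f b + d * h b)) \<longlongrightarrow> c * L f + d * L h) G"
      by (rule Lim_transform_eventually[rotated])
  qed
  have mono: "L f \<le> L h" if "bdd_on_K f" "bdd_on_K h" "\<And>b. b \<in> K \<Longrightarrow> f b \<le> h b" for f h
  proof (rule tendsto_le[OF Gbot lim lim evG])
    have "A N f \<le> A N h" for N
      using that u_mono[OF that(3)]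
      by (auto simp: A_def simp del: sum.lessThan_Suc intro!: divide_right_mono sum_mono)
    then show "\<forall>\<^sub>F N in sequentially. A N f \<le> A N h" by simp
  qed
  have bdd1: "bdd_on_K (\<lambda>_. 1)" unfolding bdd_on_K_def by auto
  have "1 / E \<le> A N (\<lambda>_. 1)" for N
  proof -
    have "real (Suc N) * (1 / E) \<le> (\<Sum>n<Suc N. u (\<lambda>_. 1) n)"
      using sum_bounded_below[of "{..<Suc N}" "1 / E" "u (\<lambda>_. 1)"] u_1 by simp
    then show ?thesis using bdd1 E1 by (simp add: A_def pos_le_divide_eq mult.commute del: sum.lessThan_Suc)
  qed
  then have "1 / E \<le> L (\<lambda>_. 1)"
    by (intro tendsto_lowerbound[OF lim _ Gbot] evG) simp
  then have pos: "L (\<lambda>_. 1) > 0" using E1 by (smt (verit) divide_pos_pos)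
  have eig: "L (T f) = r * L f" if f: "bdd_on_K f" for f
  proof -
    \<comment> \<open>Applying T shifts the orbit by one step, so the sums telescope and the defect
      in the eigenvalue equation is O(1 / N).\<close>
    have "\<bar>A N (T f) - r * A N f\<bar> \<le> 2 * r * (M f * E) / Suc N" for N
    proof -
      have "(\<Sum>n<Suc N. u (T f) n) - r * (\<Sum>n<Suc N. u f n) = r * (\<Sum>n<Suc N. u f (Suc n) - u f n)"
        by (simp add: u_T sum_distrib_left sum_subtractf right_diff_distrib del: sum.lessThan_Suc)
      also have "\<dots> = r * (u f (Suc N) - u f 0)" by (simp only: sum_lessThan_telescope)
      finally have eq: "A N (T f) - r * A N f = r * (u f (Suc N) - u f 0) / Suc N"
        using f bdd_T[OF f] by (simp add: A_def flip: diff_divide_distrib del: sum.lessThan_Suc)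
      have "\<bar>u f (Suc N) - u f 0\<bar> \<le> 2 * (M f * E)"
        using u_M[OF f, of "Suc N"] u_M[OF f, of 0] by linarith
      then have "r * \<bar>u f (Suc N) - u f 0\<bar> \<le> r * (2 * (M f * E))" using r(1) by (intro mult_left_mono) auto
      then show ?thesis unfolding eq using r(1) by (simp add: abs_mult divide_right_mono)
    qed
    moreover have "(\<lambda>N. 2 * r * (M f * E) / Suc N) \<longlonglongrightarrow> 0"
      by (rule LIMSEQ_Suc[OF lim_const_over_n])
    ultimately have "(\<lambda>N. A N (T f) - r * A N f) \<longlonglongrightarrow> 0"
      by (rule_tac Lim_null_comparison[where g = "\<lambda>N. 2 * r * (M f * E) / Suc N"]) auto
    then have "((\<lambda>F. F (T f) - r * F f) \<longlongrightarrow> 0) (filtermap A sequentially)"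
      by (simp add: filterlim_filtermap)
    then have 0: "((\<lambda>F. F (T f) - r * F f) \<longlongrightarrow> 0) G"
      by (rule tendsto_mono[OF GleA])
    have "((\<lambda>F. F (T f) - r * F f) \<longlongrightarrow> L (T f) - r * L f) G" by (intro tendsto_intros lim)
    from tendsto_unique[OF Gbot this 0] show ?thesis by simp
  qed
  have "mobius_eigen B g s L r"
    by (intro mobius_eigen.intro mobius_system_axioms mobius_eigen_axioms.intro pos lin mono eig)
  then show ?thesis by blast
qed

section \<open>Uniqueness\<close>

lemma Lam_eq:
  assumes "\<And>\<beta>. \<beta> \<in> B \<Longrightarrow> z + \<beta> \<noteq> 0"
  shows "Lam B s f z = (\<Sum>\<beta>\<in>B. riesz_kernel s (z + \<beta>) * f (inverse (z + \<beta>)))"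
  unfolding Lam_def
proof (intro sum.cong refl)
  fix \<beta> assume "\<beta> \<in> B"
  then have z: "z + \<beta> \<noteq> 0" using assms by blast
  then have "((\<lambda>w. inverse (w + \<beta>)) has_field_derivative - (inverse ((z + \<beta>)\<^sup>2))) (at z)"
    by (auto intro!: derivative_eq_intros simp: power2_eq_square)
  then have "cmod (deriv (\<lambda>w. inverse (w + \<beta>)) z) = inverse (nsq (z + \<beta>))"
    by (simp add: DERIV_imp_deriv norm_inverse norm_power nsq_eq_cmod)
  then show "cmod (deriv (\<lambda>w. inverse (w + \<beta>)) z) powr s * f (inverse (z + \<beta>))
      = riesz_kernel s (z + \<beta>) * f (inverse (z + \<beta>))"
    by (simp add: riesz_kernel_def powr_minus inverse_powr nsq_def)
qed

context mobius_system
begin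

lemma shift_nz: "Re z \<ge> 0 \<Longrightarrow> \<beta> \<in> B \<Longrightarrow> z + \<beta> \<noteq> 0"
  using ReB[of \<beta>] g1 by (auto simp: complex_eq_iff)

lemma Lam_eq_half_plane: "Re z \<ge> 0 \<Longrightarrow> Lam B s f z = (\<Sum>\<beta>\<in>B. riesz_kernel s (z + \<beta>) * f (inverse (z + \<beta>)))"
  using shift_nz by (intro Lam_eq) auto

lemma Re_branch: "Re z \<ge> 0 \<Longrightarrow> \<beta> \<in> B \<Longrightarrow> Re (inverse (z + \<beta>)) \<ge> 0"
  using ReB[of \<beta>] g1 by (intro Re_inverse_nonneg) simp

text \<open>For \<gamma> = 1 a single branch need not contract (\<beta> = 1 at z = 0), but its square does.\<close>

lemma branch2_contraction:
  assumes \<beta>: "\<beta> \<in> B" and z: "Re z \<ge> 0" and w: "Re w \<ge> 0"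
  defines "th \<equiv> \<lambda>z. inverse (z + \<beta>)" and "q \<equiv> inverse ((1 + Re (inverse \<beta>))\<^sup>2)"
  shows "cmod (th (th z) - th (th w)) \<le> q * cmod (z - w)" "0 < q" "q < 1"
proof -
  have Rb: "Re \<beta> \<ge> 1" using ReB[OF \<beta>] g1 by simp
  then have b0: "\<beta> \<noteq> 0" by auto
  have ib: "Re (inverse \<beta>) > 0" using Rb by (simp add: add_pos_nonneg)
  then have "1 < (1 + Re (inverse \<beta>))\<^sup>2" by (simp add: one_less_power del: inverse_complex.sel)
  then show "q < 1" unfolding q_def by (simp only: inverse_less_1_iff simp_thms)
  show "0 < q" unfolding q_def using ib by (intro positive_imp_inverse_positive zero_less_power) linarith
  \<comment> \<open>Writing 1 + \<beta> (z + \<beta>) as \<beta> (z + \<beta> + 1/\<beta>), with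
    |\<beta>| >= 1 and Re (z + \<beta>) >= 1, leaves Re (1/\<beta>) > 0 as the gain over 1.\<close>
  have ge: "cmod (1 + \<beta> * (z + \<beta>)) \<ge> 1 + Re (inverse \<beta>)" if "Re z \<ge> 0" for z
  proof -
    have "1 + \<beta> * (z + \<beta>) = \<beta> * (z + \<beta> + inverse \<beta>)" using b0 by (simp add: field_simps)
    then have "cmod (1 + \<beta> * (z + \<beta>)) = cmod \<beta> * cmod (z + \<beta> + inverse \<beta>)" by (simp add: norm_mult)
    moreover have "1 + Re (inverse \<beta>) \<le> cmod (z + \<beta> + inverse \<beta>)"
      using complex_Re_le_cmod[of "z + \<beta> + inverse \<beta>"] that Rb by (simp del: inverse_complex.sel)
    moreover have "cmod \<beta> \<ge> 1" using Rb complex_Re_le_cmod[of \<beta>] by linarith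
    ultimately show ?thesis using mult_mono[of 1 "cmod \<beta>" "1 + Re (inverse \<beta>)"] ib by (simp del: inverse_complex.sel)
  qed
  have nz: "z + \<beta> \<noteq> 0" "w + \<beta> \<noteq> 0" using shift_nz z w \<beta> by auto
  have nz2: "1 + \<beta> * (z + \<beta>) \<noteq> 0" "1 + \<beta> * (w + \<beta>) \<noteq> 0"
    using ge[OF z] ge[OF w] ib by (force simp del: inverse_complex.sel)+
  have th2: "th (th u) = (u + \<beta>) / (1 + \<beta> * (u + \<beta>))" if "u + \<beta> \<noteq> 0" for u
  proof -
    have "inverse (u + \<beta>) + \<beta> = (1 + \<beta> * (u + \<beta>)) / (u + \<beta>)" using that by (simp add: field_simps)
    then show ?thesis by (simp add: th_def)
  qed
  \<comment> \<open>The twice-iterated branch is a Moebius map of determinant 1, so the numerator of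
    the difference is exactly z - w.\<close>
  have "th (th z) - th (th w) = (z - w) / ((1 + \<beta> * (z + \<beta>)) * (1 + \<beta> * (w + \<beta>)))"
    unfolding th2[OF nz(1)] th2[OF nz(2)] using nz2 by (simp add: diff_frac_eq, simp add: algebra_simps)
  then have "cmod (th (th z) - th (th w)) = cmod (z - w) / (cmod (1 + \<beta> * (z + \<beta>)) * cmod (1 + \<beta> * (w + \<beta>)))"
    by (simp add: norm_divide norm_mult)
  also have "\<dots> \<le> cmod (z - w) / ((1 + Re (inverse \<beta>)) * (1 + Re (inverse \<beta>)))"
    using ge[OF z] ge[OF w] ib by (intro divide_left_mono mult_mono mult_pos_pos) (auto simp del: inverse_complex.sel)
  finally show "cmod (th (th z) - th (th w)) \<le> q * cmod (z - w)"
    by (simp add: q_def power2_eq_square field_simps del: inverse_complex.sel)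
qed

lemma branch_orbits_merge:
  assumes \<beta>: "\<beta> \<in> B" and z: "Re z \<ge> 0" and w: "Re w \<ge> 0"
  defines "th \<equiv> \<lambda>z. inverse (z + \<beta>)"
  shows "(\<lambda>n. dist ((th ^^ (2 * n)) z) ((th ^^ (2 * n)) w)) \<longlonglongrightarrow> 0"
proof -
  define q where "q = inverse ((1 + Re (inverse \<beta>))\<^sup>2)"
  have q: "0 < q" "q < 1" unfolding q_def by (rule branch2_contraction(2,3)[OF \<beta> z w])+
  have Re_orbit: "Re ((th ^^ n) u) \<ge> 0" if "Re u \<ge> 0" for n u
  proof (induction n)
    case (Suc n)
    have "Re (th ((th ^^ n) u)) \<ge> 0" unfolding th_def by (rule Re_branch[OF Suc[unfolded th_def] \<beta>])
    then show ?case by simp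
  qed (simp add: that)
  have "cmod ((th ^^ (2 * n)) z - (th ^^ (2 * n)) w) \<le> q ^ n * cmod (z - w)" for n
  proof (induction n)
    case (Suc n)
    have "cmod (th (th ((th ^^ (2 * n)) z)) - th (th ((th ^^ (2 * n)) w)))
      \<le> q * cmod ((th ^^ (2 * n)) z - (th ^^ (2 * n)) w)"
      using branch2_contraction(1)[OF \<beta> Re_orbit[OF z, of "2 * n"] Re_orbit[OF w, of "2 * n"]]
      unfolding q_def th_def .
    then have "cmod ((th ^^ (2 * Suc n)) z - (th ^^ (2 * Suc n)) w)
      \<le> q * cmod ((th ^^ (2 * n)) z - (th ^^ (2 * n)) w)" by simp
    also have "\<dots> \<le> q * (q ^ n * cmod (z - w))" using Suc q by (intro mult_left_mono) auto
    finally show ?case by (simp add: mult.assoc)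
  qed simp
  moreover have "(\<lambda>n. q ^ n * cmod (z - w)) \<longlonglongrightarrow> 0"
    using q by (intro tendsto_mult_left_zero LIMSEQ_realpow_zero) auto
  ultimately show ?thesis
    by (rule_tac Lim_null_comparison[where g = "\<lambda>n. q ^ n * cmod (z - w)"]) (simp_all add: dist_norm)
qed

text \<open>Maximum principle: with M the maximum of u / v, attained at z0, the function M v - u is
  nonnegative and vanishes at z0. Applying the operator gives (r - \<mu>) u z0 >= 0. If the
  eigenvalues agree, a sum of nonnegative terms with positive weights vanishes, so equality passes
  to every image of z0.\<close>

lemma ratio_maximum:
  assumes X: "compact X" "X \<noteq> {}" "\<And>z. z \<in> X \<Longrightarrow> Re z \<ge> 0"
    and inv: "\<And>z \<beta>. z \<in> X \<Longrightarrow> \<beta> \<in> B \<Longrightarrow> inverse (z + \<beta>) \<in> X"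
    and u: "continuous_on X u" "\<And>z. z \<in> X \<Longrightarrow> Lam B s u z = \<mu> * u z" 
    and v: "continuous_on X v" "\<And>z. z \<in> X \<Longrightarrow> v z > 0" "\<And>z. z \<in> X \<Longrightarrow> Lam B s v z = r * v z"
    and upos: "\<And>z. z \<in> X \<Longrightarrow> u z > 0"
  shows "\<mu> \<le> r" 
    and "\<mu> = r \<Longrightarrow> \<exists>z0\<in>X. \<exists>M>0. (\<forall>z\<in>X. u z \<le> M * v z) \<and>
            (\<forall>\<beta>\<in>B. \<forall>n. ((\<lambda>z. inverse (z + \<beta>)) ^^ n) z0 \<in> X \<and>
               u (((\<lambda>z. inverse (z + \<beta>)) ^^ n) z0) = M * v (((\<lambda>z. inverse (z + \<beta>)) ^^ n) z0))"
proof -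
  have "continuous_on X (\<lambda>z. u z / v z)"
    using u(1) v(1) v(2) by (intro continuous_intros) (auto simp: less_imp_neq[symmetric])
  then obtain z0 where z0: "z0 \<in> X" "\<And>z. z \<in> X \<Longrightarrow> u z / v z \<le> u z0 / v z0"
    using continuous_attains_sup[OF X(1,2)] by blast
  define M where "M = u z0 / v z0"
  have M: "M > 0" using upos v(2) z0(1) by (simp add: M_def)
  have le: "u z \<le> M * v z" if "z \<in> X" for z
    using z0(2)[OF that] v(2)[OF that] by (simp add: M_def pos_divide_le_eq)
  have eq0: "u z0 = M * v z0" using v(2)[OF z0(1)] by (simp add: M_def)
  have kpos: "riesz_kernel s (z + \<beta>) > 0" if "z \<in> X" "\<beta> \<in> B" for z \<beta>
    using X(3)[OF that(1)] ReB[OF that(2)] g1 by (intro riesz_kernel_pos) simp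
  have Leq: "M * Lam B s v z - Lam B s u z
      = (\<Sum>\<beta>\<in>B. riesz_kernel s (z + \<beta>) * (M * v (inverse (z + \<beta>)) - u (inverse (z + \<beta>))))" if "z \<in> X" for z
    using X(3)[OF that] by (simp add: Lam_eq_half_plane sum_distrib_left sum_subtractf algebra_simps)
  have nn: "0 \<le> riesz_kernel s (z + \<beta>) * (M * v (inverse (z + \<beta>)) - u (inverse (z + \<beta>)))" if "z \<in> X" "\<beta> \<in> B" for z \<beta>
    using kpos[OF that] le[OF inv[OF that]] by simp
  have "0 \<le> M * Lam B s v z0 - Lam B s u z0"
    unfolding Leq[OF z0(1)] by (intro sum_nonneg nn z0)
  then have "\<mu> * u z0 \<le> r * u z0" using u(2)[OF z0(1)] v(3)[OF z0(1)] eq0 by (simp add: mult_ac)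
  then show "\<mu> \<le> r" using upos[OF z0(1)] by simp
  assume "\<mu> = r"
  have step: "u (inverse (z + \<beta>)) = M * v (inverse (z + \<beta>))" if "z \<in> X" "\<beta> \<in> B" "u z = M * v z" for z \<beta>
  proof -
    have "(\<Sum>\<beta>\<in>B. riesz_kernel s (z + \<beta>) * (M * v (inverse (z + \<beta>)) - u (inverse (z + \<beta>)))) = 0"
      unfolding Leq[OF that(1), symmetric] using u(2)[OF that(1)] v(3)[OF that(1)] that(3) \<open>\<mu> = r\<close> by simp
    then have "riesz_kernel s (z + \<beta>) * (M * v (inverse (z + \<beta>)) - u (inverse (z + \<beta>))) = 0"
      by (subst (asm) sum_nonneg_eq_0_iff[OF fin nn[OF that(1)]]) (use that(2) in blast)+
    then show ?thesis using kpos[OF that(1,2)] by simp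
  qed
  have "((\<lambda>z. inverse (z + \<beta>)) ^^ n) z0 \<in> X \<and>
     u (((\<lambda>z. inverse (z + \<beta>)) ^^ n) z0) = M * v (((\<lambda>z. inverse (z + \<beta>)) ^^ n) z0)" if "\<beta> \<in> B" for \<beta> n
  proof (induction n)
    case 0
    show ?case using z0(1) eq0 by simp
  next
    case (Suc n)
    show ?case
      using inv[OF conjunct1[OF Suc] that] step[OF conjunct1[OF Suc] that conjunct2[OF Suc]] by simp
  qed
  with z0(1) M le show "\<exists>z0\<in>X. \<exists>M>0. (\<forall>z\<in>X. u z \<le> M * v z) \<and>
            (\<forall>\<beta>\<in>B. \<forall>n. ((\<lambda>z. inverse (z + \<beta>)) ^^ n) z0 \<in> X \<and>
               u (((\<lambda>z. inverse (z + \<beta>)) ^^ n) z0) = M * v (((\<lambda>z. inverse (z + \<beta>)) ^^ n) z0))"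
    by blast
qed

lemma positive_eigenvector_unique:
  assumes X: "compact X" "X \<noteq> {}" "\<And>z. z \<in> X \<Longrightarrow> Re z \<ge> 0"
    and inv: "\<And>z \<beta>. z \<in> X \<Longrightarrow> \<beta> \<in> B \<Longrightarrow> inverse (z + \<beta>) \<in> X"
    and u: "continuous_on X u" "\<And>z. z \<in> X \<Longrightarrow> u z > 0" "\<And>z. z \<in> X \<Longrightarrow> Lam B s u z = \<mu> * u z"
    and v: "continuous_on X v" "\<And>z. z \<in> X \<Longrightarrow> v z > 0" "\<And>z. z \<in> X \<Longrightarrow> Lam B s v z = r * v z"
  shows "\<exists>c>0. \<forall>z\<in>X. u z = c * v z"
proof -
  have "\<mu> \<le> r" by (rule ratio_maximum(1)[OF X inv u(1,3) v u(2)])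
  moreover have "r \<le> \<mu>" by (rule ratio_maximum(1)[OF X inv v(1,3) u v(2)])
  ultimately have eq: "\<mu> = r" by simp
  \<comment> \<open>One branch is fixed for both extremal orbits: orbits of the same map approach
    each other.\<close>
  define \<beta> where "\<beta> = b0"
  have \<beta>: "\<beta> \<in> B" using b0_in by (simp add: \<beta>_def)
  define th where "th = (\<lambda>z. inverse (z + \<beta>))"
  have "\<exists>z0\<in>X. \<exists>M>0. (\<forall>z\<in>X. u z \<le> M * v z) \<and>
     (\<forall>\<beta>\<in>B. \<forall>n. ((\<lambda>z. inverse (z + \<beta>)) ^^ n) z0 \<in> X \<and>
        u (((\<lambda>z. inverse (z + \<beta>)) ^^ n) z0) = M * v (((\<lambda>z. inverse (z + \<beta>)) ^^ n) z0))"
    by (rule ratio_maximum(2)[OF X inv u(1,3) v u(2) eq])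
  then obtain z0 M where z0: "z0 \<in> X" "M > 0" "\<And>z. z \<in> X \<Longrightarrow> u z \<le> M * v z"
    "\<And>n. (th ^^ n) z0 \<in> X" "\<And>n. u ((th ^^ n) z0) = M * v ((th ^^ n) z0)"
    using \<beta> unfolding th_def by blast
  have "\<exists>z0\<in>X. \<exists>M>0. (\<forall>z\<in>X. v z \<le> M * u z) \<and>
     (\<forall>\<beta>\<in>B. \<forall>n. ((\<lambda>z. inverse (z + \<beta>)) ^^ n) z0 \<in> X \<and>
        v (((\<lambda>z. inverse (z + \<beta>)) ^^ n) z0) = M * u (((\<lambda>z. inverse (z + \<beta>)) ^^ n) z0))"
    by (rule ratio_maximum(2)[OF X inv v(1,3) u v(2) eq[symmetric]])
  then obtain z1 N where z1: "z1 \<in> X" "N > 0" "\<And>z. z \<in> X \<Longrightarrow> v z \<le> N * u z"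
    "\<And>n. (th ^^ n) z1 \<in> X" "\<And>n. v ((th ^^ n) z1) = N * u ((th ^^ n) z1)"
    using \<beta> unfolding th_def by blast
  \<comment> \<open>Compactness makes the ratio uniformly continuous, so approaching orbits force
    its maximum M and its minimum 1 / N to coincide.\<close>
  have cont: "continuous_on X (\<lambda>z. u z / v z)"
    using u(1) v(1) v(2) by (intro continuous_intros) (auto simp: less_imp_neq[symmetric])
  have "(\<lambda>n. dist ((th ^^ (2 * n)) z0) ((th ^^ (2 * n)) z1)) \<longlonglongrightarrow> 0"
    unfolding th_def by (rule branch_orbits_merge[OF \<beta> X(3)[OF z0(1)] X(3)[OF z1(1)]])
  moreover have "\<And>x y. (\<forall>n. x n \<in> X) \<and> (\<forall>n. y n \<in> X) \<and> (\<lambda>n. dist (x n) (y n)) \<longlonglongrightarrow> 0 \<Longrightarrow>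
      (\<lambda>n. dist (u (x n) / v (x n)) (u (y n) / v (y n))) \<longlonglongrightarrow> 0"
    using compact_uniformly_continuous[OF cont X(1)] unfolding uniformly_continuous_on_sequentially by blast
  ultimately have "(\<lambda>n. dist (u ((th ^^ (2 * n)) z0) / v ((th ^^ (2 * n)) z0))
                        (u ((th ^^ (2 * n)) z1) / v ((th ^^ (2 * n)) z1))) \<longlonglongrightarrow> 0"
    using z0(4) z1(4) by simp
  moreover have "u ((th ^^ n) z0) / v ((th ^^ n) z0) = M" for n
    using z0(5)[of n] v(2)[OF z0(4)[of n]] by simp
  moreover have "u ((th ^^ n) z1) / v ((th ^^ n) z1) = 1 / N" for n
    using z1(5)[of n] z1(2) u(2)[OF z1(4)[of n]] by simp
  ultimately have MN: "M = 1 / N" by (simp add: LIMSEQ_const_iff)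
  have "u z = M * v z" if "z \<in> X" for z
  proof (rule antisym)
    show "u z \<le> M * v z" by (rule z0(3)[OF that])
    have "M * v z \<le> M * (N * u z)" using z1(3)[OF that] z0(2) by (intro mult_left_mono) auto
    then show "M * v z \<le> u z" using MN z1(2) by simp
  qed
  then show ?thesis using z0(2) by blast
qed

end

section \<open>The eigenvector and its derivatives\<close>

context mobius_eigen
begin

lemma bdd_const: "bdd_on_K (\<lambda>_. c)"
  unfolding bdd_on_K_def by auto

lemma L_scale: "bdd_on_K f \<Longrightarrow> L (\<lambda>b. c * f b) = c * L f"
  using Llin[of f f c 0] by simp

lemma L_diff: "bdd_on_K f \<Longrightarrow> bdd_on_K h \<Longrightarrow> L (\<lambda>b. f b - h b) = L f - L h"
  using Llin[of f h 1 "-1"] by simp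

lemma bdd_diff: "bdd_on_K f \<Longrightarrow> bdd_on_K h \<Longrightarrow> bdd_on_K (\<lambda>b. f b - h b)"
  using bdd_lin[of f h 1 "-1"] by simp

lemma bdd_scale: "bdd_on_K f \<Longrightarrow> bdd_on_K (\<lambda>b. c * f b)"
  using bdd_lin[of f f c 0] by simp

lemma L_const: "L (\<lambda>_. c) = c * L (\<lambda>_. 1)"
  using L_scale[OF bdd_const, of c 1] by simp

lemma L_abs:
  assumes "bdd_on_K f" "\<And>b. b \<in> K \<Longrightarrow> \<bar>f b\<bar> \<le> M"
  shows "\<bar>L f\<bar> \<le> M * L (\<lambda>_. 1)"
proof -
  have M: "f b \<le> M" "- M \<le> f b" if "b \<in> K" for b
    using assms(2)[OF that] by linarith+
  have "L f \<le> L (\<lambda>_. M)" by (rule Lmono[OF assms(1) bdd_const M(1)])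
  moreover have "L (\<lambda>_. - M) \<le> L f" by (rule Lmono[OF bdd_const assms(1) M(2)])
  ultimately show ?thesis unfolding L_const[of M] L_const[of "- M"] by linarith
qed

lemma L_sum:
  assumes "finite A" "\<And>i. i \<in> A \<Longrightarrow> bdd_on_K (f i)"
  shows "bdd_on_K (\<lambda>b. \<Sum>i\<in>A. c i * f i b) \<and> L (\<lambda>b. \<Sum>i\<in>A. c i * f i b) = (\<Sum>i\<in>A. c i * L (f i))"
  using assms
proof (induction A rule: finite_induct)
  case empty
  then show ?case using bdd_const[of 0] L_const[of 0] by simp
next
  case (insert i A)
  then have IH: "bdd_on_K (\<lambda>b. \<Sum>i\<in>A. c i * f i b)"
    "L (\<lambda>b. \<Sum>i\<in>A. c i * f i b) = (\<Sum>i\<in>A. c i * L (f i))" and i: "bdd_on_K (f i)" by auto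
  show ?case
    using insert(1,2) bdd_lin[OF i IH(1), of "c i" 1] Llin[OF i IH(1), of "c i" 1] IH(2) by simp
qed

section \<open>Differentiation under the eigenfunctional\<close>

definition J :: "(complex \<Rightarrow> real) \<Rightarrow> complex \<Rightarrow> real" where
  "J h z = L (\<lambda>b. h (z + b))"

text \<open>An open half plane around the closure of H, which may touch Re z = 0. Derivatives at
  boundary points thus become ordinary two-sided ones. The margin 1/2 is half of the guaranteed Re b
  >= 1, so arguments z + b keep real part above 1/2.\<close>

definition U :: "complex set" where "U = {z. Re z > - 1 / 2}"

lemma U_shift: "z \<in> U \<Longrightarrow> b \<in> K \<Longrightarrow> Re (z + b) > 1 / 2"
  using K_D(3)[of b] by (simp add: U_def)

lemma bdd_shift: "symbol h \<Longrightarrow> z \<in> U \<Longrightarrow> bdd_on_K (\<lambda>b. h (z + b))"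
  using symbol_bounded[of h "1 / 2"] U_shift[of z] unfolding bdd_on_K_def by (meson less_eq_real_def zero_less_divide_1_iff zero_less_numeral)

text \<open>L is applied to the second-order Taylor remainder, uniform in b; by positivity the
  remainder of J h is at most C t^2 L 1.\<close>

lemma J_deriv:
  assumes h: "symbol h" "symbol h'" and e: "e \<in> {1, \<i>}"
    and d: "\<And>z. Re z > 0 \<Longrightarrow> ((\<lambda>t::real. h (z + of_real t * e)) has_real_derivative h' z) (at 0)"
    and z: "z \<in> U"
  shows "((\<lambda>t::real. J h (z + of_real t * e)) has_real_derivative J h' z) (at 0)"
proof -
  obtain C where C: "C \<ge> 0" "\<And>z t. Re z > 1 / 2 \<Longrightarrow> Re (z + of_real t * e) > 1 / 2 \<Longrightarrow>
      \<bar>h (z + of_real t * e) - h z - t * h' z\<bar> \<le> C * t\<^sup>2"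
    using symbol_taylor[OF h, of "1 / 2" e] d e by auto
  have bd: "\<bar>J h (z + of_real t * e) - J h z - t * J h' z\<bar> \<le> C * t\<^sup>2 * L (\<lambda>_. 1)"
    if t: "z + of_real t * e \<in> U" for t
  proof -
    note b1 = bdd_shift[OF h(1) t] and b2 = bdd_shift[OF h(1) z] and b3 = bdd_shift[OF h(2) z]
    have "J h (z + of_real t * e) - J h z - t * J h' z
        = L (\<lambda>b. h (z + of_real t * e + b) - h (z + b) - t * h' (z + b))"
      unfolding J_def L_diff[OF bdd_diff[OF b1 b2] bdd_scale[OF b3]] L_diff[OF b1 b2] L_scale[OF b3] ..
    moreover have "\<bar>h (z + of_real t * e + b) - h (z + b) - t * h' (z + b)\<bar> \<le> C * t\<^sup>2" if "b \<in> K" for b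
      using C(2)[OF U_shift[OF z that], of t] U_shift[OF t that] by (simp add: add_ac)
    ultimately show ?thesis
      using L_abs[OF bdd_diff[OF bdd_diff[OF b1 b2] bdd_scale[OF b3]]] by presburger
  qed
  have "\<forall>\<^sub>F t in at 0. norm ((J h (z + of_real (0 + t) * e) - J h (z + of_real 0 * e)) / t - J h' z) \<le> C * \<bar>t\<bar> * L (\<lambda>_. 1)"
  proof -
    have "\<forall>\<^sub>F t::real in at 0. Re (z + of_real t * e) > - 1 / 2"
      using eventually_Re_line[of "- 1 / 2" z e] z by (simp add: U_def eventually_nhds_conv_at)
    moreover have "\<forall>\<^sub>F t::real in at 0. t \<noteq> 0" by (simp add: eventually_at_filter)
    ultimately show ?thesis
    proof eventually_elim
      case (elim t)
      have "\<bar>J h (z + of_real t * e) - J h z - t * J h' z\<bar> / \<bar>t\<bar> \<le> C * t\<^sup>2 * L (\<lambda>_. 1) / \<bar>t\<bar>"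
        using elim bd[of t] by (intro divide_right_mono) (auto simp: U_def)
      also have "C * t\<^sup>2 * L (\<lambda>_. 1) / \<bar>t\<bar> = C * \<bar>t\<bar> * L (\<lambda>_. 1)"
        using elim(2) by (simp add: power2_eq_square abs_if)
      finally show ?case using elim(2) by (simp add: diff_divide_distrib flip: abs_divide)
    qed
  qed
  moreover have "((\<lambda>t::real. C * \<bar>t\<bar> * L (\<lambda>_. 1)) \<longlongrightarrow> 0) (at 0)"
    by (auto intro!: tendsto_eq_intros)
  ultimately have "((\<lambda>t::real. (J h (z + of_real (0 + t) * e) - J h (z + of_real 0 * e)) / t - J h' z) \<longlongrightarrow> 0) (at 0)"
    by (rule Lim_null_comparison)
  then show ?thesis unfolding DERIV_def by (rule LIM_zero_cancel)
qed

lemma J_continuous: assumes h: "symbol h" shows "continuous_on U (J h)"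
proof -
  obtain C where C: "C \<ge> 0" "\<And>z w. Re z > 1 / 2 \<Longrightarrow> Re w > 1 / 2 \<Longrightarrow> \<bar>h w - h z\<bar> \<le> C * cmod (w - z)"
    using symbol_lipschitz[OF h, of "1 / 2"] by auto
  have "(C * L (\<lambda>_. 1))-lipschitz_on U (J h)"
  proof (rule lipschitz_onI)
    fix w z assume zw: "w \<in> U" "z \<in> U"
    note b1 = bdd_shift[OF h zw(1)] and b2 = bdd_shift[OF h zw(2)]
    have "\<bar>h (w + b) - h (z + b)\<bar> \<le> C * cmod (w - z)" if "b \<in> K" for b
      using C(2)[OF U_shift[OF zw(2) that] U_shift[OF zw(1) that]] by simp
    then have "\<bar>L (\<lambda>b. h (w + b) - h (z + b))\<bar> \<le> C * cmod (w - z) * L (\<lambda>_. 1)"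
      by (rule L_abs[OF bdd_diff[OF b1 b2]])
    then show "dist (J h w) (J h z) \<le> C * L (\<lambda>_. 1) * dist w z"
      unfolding L_diff[OF b1 b2] J_def dist_norm by (simp add: mult_ac)
  qed (use C(1) L1 in simp)
  then show ?thesis by (rule lipschitz_on_continuous_on)
qed

lemma J_mono:
  assumes "symbol h" "symbol k" "z \<in> U" "\<And>b. b \<in> K \<Longrightarrow> c * h (z + b) \<le> k (z + b)"
  shows "c * J h z \<le> J k z"
proof -
  note bh = bdd_shift[OF assms(1,3)]
  have "L (\<lambda>b. c * h (z + b)) \<le> L (\<lambda>b. k (z + b))"
    by (rule Lmono[OF bdd_scale[OF bh] bdd_shift[OF assms(2,3)] assms(4)])
  then show ?thesis unfolding L_scale[OF bh] by (simp only: J_def)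
qed

text \<open>One symbol k represents the derivative of h and, after applying J, that of J h. This
  yields smoothness of every order and allows pointwise kernel bounds to be transferred.\<close>

lemma pd_J:
  assumes h: "symbol h" and es: "set es \<subseteq> {1, \<i>}"
  shows "\<exists>k. symbol k \<and> (\<forall>w. Re w > 0 \<longrightarrow> pd es h w = k w) \<and> (\<forall>z\<in>U. pd es (J h) z = J k z)"
  using es
proof (induction es)
  case Nil
  then show ?case using h by auto
next
  case (Cons e es)
  then obtain k where k: "symbol k" "\<And>w. Re w > 0 \<Longrightarrow> pd es h w = k w" "\<And>z. z \<in> U \<Longrightarrow> pd es (J h) z = J k z"
    by auto
  have e: "e \<in> {1, \<i>}" using Cons by auto
  obtain k' where k': "symbol k'" "\<And>z. Re z > 0 \<Longrightarrow> ((\<lambda>t::real. k (z + of_real t * e)) has_real_derivative k' z) (at 0)"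
    using symbol_deriv[OF k(1) e] by blast
  have "pd (e # es) (J h) z = J k' z" if "z \<in> U" for z
    using dpart_eq(2)[of "- 1 / 2" "pd es (J h)" "J k" z e, OF _ _ J_deriv[OF k(1) k'(1) e k'(2) that]] k(3) that
    by (auto simp: U_def)
  moreover have "pd (e # es) h w = k' w" if "Re w > 0" for w
    using dpart_eq(2)[OF k(2) that k'(2)[OF that]] by simp
  ultimately show ?case using k'(1) by blast
qed

definition v :: "complex \<Rightarrow> real" where "v = J (riesz_kernel s)"

lemma symbol_k: "symbol (riesz_kernel s)" using s0 by (intro symbol_riesz_kernel) simp

lemma nonneg_U: "Re z \<ge> 0 \<Longrightarrow> z \<in> U" by (simp add: U_def)

text \<open>Monotonicity alone would give v z >= 0. Strictness comes from a lower bound for the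
  kernel uniform over b in \<open>K\<close>, together with L 1 > 0.\<close>

lemma v_pos:
  assumes z: "Re z \<ge> 0" shows "v z > 0"
proof -
  have c: "(cmod z + R) powr (- (2 * s)) > 0"
  proof -
    have "cmod z + R \<noteq> 0" using R1 norm_ge_zero[of z] by linarith
    then show ?thesis by simp
  qed
  have "(cmod z + R) powr (- (2 * s)) \<le> riesz_kernel s (z + b)" if "b \<in> K" for b
  proof -
    have "cmod (z + b) \<le> cmod z + R" using norm_triangle_ineq[of z b] K_D(4)[OF that] by linarith
    moreover have "cmod (z + b) > 0"
      using complex_Re_le_cmod[of "z + b"] z K_D(3)[OF that] unfolding plus_complex.sel by linarith
    ultimately have "(cmod z + R) powr (- 2 * s) \<le> cmod (z + b) powr (- 2 * s)"
      using s0 by (intro powr_mono2') simp_all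
    then show ?thesis by (simp add: riesz_kernel_cmod)
  qed
  then have "(cmod z + R) powr (- (2 * s)) * L (\<lambda>_. 1) \<le> v z"
    unfolding v_def J_def L_const[of "(cmod z + R) powr (- (2 * s))", symmetric]
    by (rule Lmono[OF bdd_const bdd_shift[OF symbol_k nonneg_U[OF z]]])
  then show ?thesis using mult_pos_pos[OF c L1] by linarith
qed

lemma v_eigen:
  assumes z: "Re z \<ge> 0" shows "Lam B s v z = r * v z"
proof -
  let ?f = "\<lambda>b. \<Sum>\<beta>\<in>B. riesz_kernel s (z + \<beta>) * riesz_kernel s (inverse (z + \<beta>) + b)"
  have b: "bdd_on_K (\<lambda>b. riesz_kernel s (inverse (z + \<beta>) + b))" if "\<beta> \<in> B" for \<beta>
    using bdd_shift[OF symbol_k nonneg_U[OF Re_branch[OF z that]]] .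
  have bz: "bdd_on_K (\<lambda>b. riesz_kernel s (z + b))" by (rule bdd_shift[OF symbol_k nonneg_U[OF z]])
  have "Lam B s v z = (\<Sum>\<beta>\<in>B. riesz_kernel s (z + \<beta>) * L (\<lambda>b. riesz_kernel s (inverse (z + \<beta>) + b)))"
    by (simp add: Lam_eq_half_plane[OF z] v_def J_def)
  also have "\<dots> = L ?f" using L_sum[OF fin b] by simp
  \<comment> \<open>The two arguments of L are known to agree on \<open>K\<close> only; monotonicity
    in both directions turns this into equality of the values of L.\<close>
  also have "\<dots> = L (T (\<lambda>b. riesz_kernel s (z + b)))"
    using L_sum[OF fin b] bdd_T[OF bz] by (intro antisym Lmono) (auto simp: intertwine[OF z])
  also have "\<dots> = r * v z" using Leig[OF bz] by (simp add: v_def J_def)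
  finally show ?thesis .
qed

lemma pd_v_ge:
  assumes es: "set es \<subseteq> {1, \<i>}" and z: "Re z \<ge> 0"
    and le: "\<And>w. Re w \<ge> g \<Longrightarrow> c * riesz_kernel s w \<le> pd es (riesz_kernel s) w"
  shows "c * v z \<le> pd es v z"
proof -
  obtain k where k: "symbol k" "\<And>w. Re w > 0 \<Longrightarrow> pd es (riesz_kernel s) w = k w" "\<And>z. z \<in> U \<Longrightarrow> pd es v z = J k z"
    using pd_J[OF symbol_k es] unfolding v_def by blast
  have "c * riesz_kernel s (z + b) \<le> k (z + b)" if "b \<in> K" for b
    using le[of "z + b"] k(2)[of "z + b"] z K_D(1,2)[OF that] by simp
  then show ?thesis
    unfolding k(3)[OF nonneg_U[OF z]] unfolding v_def by (rule J_mono[OF symbol_k k(1) nonneg_U[OF z]])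
qed

lemma pd_v_le:
  assumes es: "set es \<subseteq> {1, \<i>}" and z: "Re z \<ge> 0"
    and le: "\<And>w. Re w \<ge> g \<Longrightarrow> pd es (riesz_kernel s) w \<le> c * riesz_kernel s w"
  shows "pd es v z \<le> c * v z"
proof -
  obtain k where k: "symbol k" "\<And>w. Re w > 0 \<Longrightarrow> pd es (riesz_kernel s) w = k w" "\<And>z. z \<in> U \<Longrightarrow> pd es v z = J k z"
    using pd_J[OF symbol_k es] unfolding v_def by blast
  have "k (z + b) \<le> c * riesz_kernel s (z + b)" if "b \<in> K" for b
    using le[of "z + b"] k(2)[of "z + b"] z K_D(1,2)[OF that] by simp
  then have "L (\<lambda>b. k (z + b)) \<le> L (\<lambda>b. c * riesz_kernel s (z + b))"
    by (rule Lmono[OF bdd_shift[OF k(1) nonneg_U[OF z]] bdd_scale[OF bdd_shift[OF symbol_k nonneg_U[OF z]]]])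
  then show ?thesis
    unfolding k(3)[OF nonneg_U[OF z]] L_scale[OF bdd_shift[OF symbol_k nonneg_U[OF z]]] by (simp only: v_def J_def)
qed

lemma pd_v_continuous: "set es \<subseteq> {1, \<i>} \<Longrightarrow> continuous_on U (pd es v)"
  using pd_J[OF symbol_k, of es] J_continuous unfolding v_def by (metis continuous_on_cong)

lemma pd_v_deriv:
  assumes es: "set es \<subseteq> {1, \<i>}" and e: "e \<in> {1, \<i>}" and z: "z \<in> U"
  shows "\<exists>D. ((\<lambda>t::real. pd es v (z + of_real t * e)) has_real_derivative D) (at 0)"
proof -
  obtain k where k: "symbol k" "\<And>z. z \<in> U \<Longrightarrow> pd es v z = J k z"
    using pd_J[OF symbol_k es] unfolding v_def by blast
  obtain k' where k': "symbol k'" "\<And>z. Re z > 0 \<Longrightarrow> ((\<lambda>t::real. k (z + of_real t * e)) has_real_derivative k' z) (at 0)"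
    using symbol_deriv[OF k(1) e] by blast
  show ?thesis
    using dpart_eq(1)[of "- 1 / 2" "pd es v" "J k" z e, OF _ _ J_deriv[OF k(1) k'(1) e k'(2) z]] k(2) z
    by (auto simp: U_def)
qed

lemma v_Cm_bar:
  assumes "closure H \<subseteq> U" shows "Cm_bar k H v"
proof -
  have H: "H \<subseteq> U" using assms closure_subset by blast
  have cont: "continuous_on (closure H) (pd es v)" if "set es \<subseteq> {1, \<i>}" for es
    by (rule continuous_on_subset[OF pd_v_continuous[OF that] assms])
  show ?thesis
    unfolding Cm_bar_def
  proof (intro conjI allI impI ballI)
    show "continuous_on (closure H) v" using cont[of "[]"] by simp
    show "\<exists>D. ((\<lambda>t::real. pd es v (z + of_real t * e)) has_real_derivative D) (at 0)"
      if "set es \<subseteq> {1, \<i>} \<and> length es < k" "z \<in> H" "e \<in> {1, \<i>}" for es z e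
      using pd_v_deriv that H by blast
    fix es assume es: "set es \<subseteq> {1, \<i>} \<and> length es \<le> k"
    show "continuous_on H (pd es v)"
      using continuous_on_subset[OF cont closure_subset] es by blast
    show "\<exists>h. continuous_on (closure H) h \<and> (\<forall>z\<in>H. h z = pd es v z)"
      using cont es by blast
  qed
qed

text \<open>The derivative is continuous on the open set \<open>U\<close> containing the closure of
  H, so its continuous extension from H is its own value. \<open>Lim\<close> determines this value
  because z is a limit point of H, both inside H and on its boundary.\<close>

lemma pd_bar_v:
  assumes "open H" "closure H \<subseteq> U" "z \<in> closure H" and es: "set es \<subseteq> {1, \<i>}"
  shows "pd_bar H es v z = pd es v z"
proof -
  have "open U" unfolding U_def by (rule open_halfspace_Re_gt)
  moreover have zU: "z \<in> U" using assms by blast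
  ultimately have "isCont (pd es v) z"
    using pd_v_continuous[OF es] continuous_on_eq_continuous_at by blast
  then have "(pd es v \<longlongrightarrow> pd es v z) (at z within H)"
    by (simp add: continuous_at continuous_within tendsto_within_subset[where S = UNIV])
  moreover have "at z within H \<noteq> bot"
  proof (cases "z \<in> H")
    case True
    then show ?thesis using assms(1) at_within_open[of z H] by simp
  next
    case False
    then have "z islimpt H" using assms(3) by (simp add: closure_def)
    then show ?thesis by (simp add: trivial_limit_within)
  qed
  ultimately show ?thesis unfolding pd_bar_def by (intro tendsto_Lim)
qed

lemma derivative_bounds:
  assumes z: "Re z \<ge> 0"
  shows "- 2 * s / g \<le> pd [1] v z / v z" "pd [1] v z / v z \<le> 0"
    "- s / (4 * g\<^sup>2 * (s + 1)) \<le> pd [1, 1] v z / v z"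
    "pd [1, 1] v z / v z \<le> 2 * s * (2 * s + 1) / g\<^sup>2"
    "- 2 * s * (2 * s + 1) * (2 * s + 2) / g ^ 3 \<le> pd [1, 1, 1] v z / v z"
    "pd [1, 1, 1] v z / v z \<le> (2 * s) * (2 * s + 2) / (g ^ 3 * (s + 2)\<^sup>2)"
    "- 2 * s * (2 * s + 2) * (3 * s + 3) / g ^ 4 \<le> pd [1, 1, 1, 1] v z / v z"
    "pd [1, 1, 1, 1] v z / v z \<le> (2 * s) * (2 * s + 1) * (2 * s + 2) * (2 * s + 3) / g ^ 4"
    "- (s / g) \<le> pd [\<i>] v z / v z" "pd [\<i>] v z / v z \<le> s / g"
    "- 2 * s / g\<^sup>2 \<le> pd [\<i>, \<i>] v z / v z"
    "pd [\<i>, \<i>] v z / v z \<le> 2 * s * (2 * s + 1) / (4 * g\<^sup>2)"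
    "- ((2 * s) * (2 * s + 2) / g ^ 3 * max (25 * sqrt 5 / 72) ((2 * s + 1) / 8)) \<le> pd [\<i>, \<i>, \<i>] v z / v z"
    "pd [\<i>, \<i>, \<i>] v z / v z \<le> (2 * s) * (2 * s + 2) / g ^ 3 * max (25 * sqrt 5 / 72) ((2 * s + 1) / 8)"
    "- 2 * s * (2 * s + 2) * (3 * s + 3) / g ^ 4 \<le> pd [\<i>, \<i>, \<i>, \<i>] v z / v z"
    "pd [\<i>, \<i>, \<i>, \<i>] v z / v z \<le> (2 * s) * (2 * s + 1) * (2 * s + 2) * (2 * s + 3) / g ^ 4"
proof -
  have lo: "c \<le> pd es v z / v z" if "set es \<subseteq> {1, \<i>}" "\<And>w. Re w \<ge> g \<Longrightarrow> c * riesz_kernel s w \<le> pd es (riesz_kernel s) w" for c es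
    using pd_v_ge[OF that(1) z that(2)] v_pos[OF z] by (simp add: pos_le_divide_eq)
  have hi: "pd es v z / v z \<le> c" if "set es \<subseteq> {1, \<i>}" "\<And>w. Re w \<ge> g \<Longrightarrow> pd es (riesz_kernel s) w \<le> c * riesz_kernel s w" for c es
    using pd_v_le[OF that(1) z that(2)] v_pos[OF z] by (simp add: pos_divide_le_eq)
  have g0: "g > 0" using g1 by simp
  note kb = riesz_kernel_derivative_bounds[OF _ g0 s0]
  show "- 2 * s / g \<le> pd [1] v z / v z" by (rule lo[OF _ kb(1)]) simp_all
  show "pd [1] v z / v z \<le> 0" by (rule hi[OF _ kb(2)]) simp_all
  show "- s / (4 * g\<^sup>2 * (s + 1)) \<le> pd [1, 1] v z / v z" by (rule lo[OF _ kb(3)]) simp_all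
  show "pd [1, 1] v z / v z \<le> 2 * s * (2 * s + 1) / g\<^sup>2" by (rule hi[OF _ kb(4)]) simp_all
  show "- 2 * s * (2 * s + 1) * (2 * s + 2) / g ^ 3 \<le> pd [1, 1, 1] v z / v z" by (rule lo[OF _ kb(5)]) simp_all
  show "pd [1, 1, 1] v z / v z \<le> (2 * s) * (2 * s + 2) / (g ^ 3 * (s + 2)\<^sup>2)" by (rule hi[OF _ kb(6)]) simp_all
  show "- 2 * s * (2 * s + 2) * (3 * s + 3) / g ^ 4 \<le> pd [1, 1, 1, 1] v z / v z" by (rule lo[OF _ kb(7)]) simp_all
  show "pd [1, 1, 1, 1] v z / v z \<le> (2 * s) * (2 * s + 1) * (2 * s + 2) * (2 * s + 3) / g ^ 4" by (rule hi[OF _ kb(8)]) simp_all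
  show "- (s / g) \<le> pd [\<i>] v z / v z" by (rule lo[OF _ kb(9)]) simp_all
  show "pd [\<i>] v z / v z \<le> s / g" by (rule hi[OF _ kb(10)]) simp_all
  show "- 2 * s / g\<^sup>2 \<le> pd [\<i>, \<i>] v z / v z" by (rule lo[OF _ kb(11)]) simp_all
  show "pd [\<i>, \<i>] v z / v z \<le> 2 * s * (2 * s + 1) / (4 * g\<^sup>2)" by (rule hi[OF _ kb(12)]) simp_all
  show "- ((2 * s) * (2 * s + 2) / g ^ 3 * max (25 * sqrt 5 / 72) ((2 * s + 1) / 8)) \<le> pd [\<i>, \<i>, \<i>] v z / v z"
    by (rule lo[OF _ kb(13)]) simp_all
  show "pd [\<i>, \<i>, \<i>] v z / v z \<le> (2 * s) * (2 * s + 2) / g ^ 3 * max (25 * sqrt 5 / 72) ((2 * s + 1) / 8)"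
    by (rule hi[OF _ kb(14)]) simp_all
  show "- 2 * s * (2 * s + 2) * (3 * s + 3) / g ^ 4 \<le> pd [\<i>, \<i>, \<i>, \<i>] v z / v z" by (rule lo[OF _ kb(15)]) simp_all
  show "pd [\<i>, \<i>, \<i>, \<i>] v z / v z \<le> (2 * s) * (2 * s + 1) * (2 * s + 2) * (2 * s + 3) / g ^ 4"
    by (rule hi[OF _ kb(16)]) simp_all
qed

end

section \<open>Comparison of the constants with rising factorials\<close>

text \<open>For the combined estimate: where the two sides of a derivative bound have different
  constants, or the constant is a sharper one, it is dominated by 2s (2s + 1) ... (2s + j - 1) /
  \<gamma>^j.\<close>

lemma derivative_constants:
  fixes g s :: real
  assumes g: "g > 0" and s: "s > 0"
  shows "s / (4 * g\<^sup>2 * (s + 1)) \<le> 2 * s * (2 * s + 1) / g\<^sup>2"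
    "2 * s * (2 * s + 2) / (g ^ 3 * (s + 2)\<^sup>2) \<le> 2 * s * (2 * s + 1) * (2 * s + 2) / g ^ 3"
    "2 * s * (2 * s + 2) * (3 * s + 3) / g ^ 4 \<le> 2 * s * (2 * s + 1) * (2 * s + 2) * (2 * s + 3) / g ^ 4"
    "s / g \<le> 2 * s / g"
    "2 * s / g\<^sup>2 \<le> 2 * s * (2 * s + 1) / g\<^sup>2"
    "2 * s * (2 * s + 1) / (4 * g\<^sup>2) \<le> 2 * s * (2 * s + 1) / g\<^sup>2"
    "2 * s * (2 * s + 2) / g ^ 3 * max (25 * sqrt 5 / 72) ((2 * s + 1) / 8) \<le> 2 * s * (2 * s + 1) * (2 * s + 2) / g ^ 3"
proof -
  have frac: "a / (d * e) \<le> b / d" if "a \<le> b * e" "e > 0" "d > 0" for a b d e :: real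
    using that by (simp add: field_simps)
  have "s \<le> 2 * s * (2 * s + 1) * (4 * (s + 1))" using s by (simp add: algebra_simps)
  then have "s / (g\<^sup>2 * (4 * (s + 1))) \<le> 2 * s * (2 * s + 1) / g\<^sup>2"
    by (rule frac) (use g s in auto)
  then show "s / (4 * g\<^sup>2 * (s + 1)) \<le> 2 * s * (2 * s + 1) / g\<^sup>2"
    by (simp only: mult_ac)
  have "1 * 1 \<le> (2 * s + 1) * (s + 2)\<^sup>2" using s by (intro mult_mono one_le_power) auto
  then have "2 * s * (2 * s + 2) * 1 \<le> 2 * s * (2 * s + 2) * ((2 * s + 1) * (s + 2)\<^sup>2)"
    using s by (intro mult_left_mono) auto
  then have "2 * s * (2 * s + 2) \<le> 2 * s * (2 * s + 1) * (2 * s + 2) * (s + 2)\<^sup>2" by (simp only: mult_ac mult_1)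
  from frac[OF this, of "g ^ 3"] 
  show "2 * s * (2 * s + 2) / (g ^ 3 * (s + 2)\<^sup>2) \<le> 2 * s * (2 * s + 1) * (2 * s + 2) / g ^ 3"
    using g s by simp
  have "3 * s + 3 \<le> (2 * s + 1) * (2 * s + 3)" using s by (simp add: algebra_simps)
  then have "2 * s * (2 * s + 2) * (3 * s + 3) \<le> 2 * s * (2 * s + 2) * ((2 * s + 1) * (2 * s + 3))"
    using s by (intro mult_left_mono) auto
  then have "2 * s * (2 * s + 2) * (3 * s + 3) \<le> 2 * s * (2 * s + 1) * (2 * s + 2) * (2 * s + 3)"
    by (simp only: mult_ac)
  then show "2 * s * (2 * s + 2) * (3 * s + 3) / g ^ 4 \<le> 2 * s * (2 * s + 1) * (2 * s + 2) * (2 * s + 3) / g ^ 4"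
    using g by (intro divide_right_mono) auto
  show "s / g \<le> 2 * s / g" using g s by (intro divide_right_mono) auto
  show "2 * s / g\<^sup>2 \<le> 2 * s * (2 * s + 1) / g\<^sup>2" using s by (intro divide_right_mono) auto
  have "2 * s * (2 * s + 1) \<le> 2 * s * (2 * s + 1) * 4" using s by simp
  from frac[OF this, of "g\<^sup>2"] show "2 * s * (2 * s + 1) / (4 * g\<^sup>2) \<le> 2 * s * (2 * s + 1) / g\<^sup>2"
    using g by (simp add: mult.commute)
  \<comment> \<open>Rational bound making 25 sqrt 5 / 72 less than 1, hence less than 2 s +
    1.\<close>
  have "sqrt 5 \<le> 5 / 2" by (rule real_le_lsqrt) (simp_all add: power2_eq_square)
  then have "max (25 * sqrt 5 / 72) ((2 * s + 1) / 8) \<le> 2 * s + 1" using s by simp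
  then have "2 * s * (2 * s + 2) / g ^ 3 * max (25 * sqrt 5 / 72) ((2 * s + 1) / 8) \<le> 2 * s * (2 * s + 2) / g ^ 3 * (2 * s + 1)"
    using g s by (intro mult_left_mono) auto
  also have "\<dots> = 2 * s * (2 * s + 1) * (2 * s + 2) / g ^ 3" by simp
  finally show "2 * s * (2 * s + 2) / g ^ 3 * max (25 * sqrt 5 / 72) ((2 * s + 1) / 8) \<le> 2 * s * (2 * s + 1) * (2 * s + 2) / g ^ 3" .
qed

lemma pochhammer_numerals:
  fixes x :: real
  shows "pochhammer x 1 = x" "pochhammer x 2 = x * (x + 1)"
    "pochhammer x 3 = x * (x + 1) * (x + 2)" "pochhammer x 4 = x * (x + 1) * (x + 2) * (x + 3)"
proof -
  show "pochhammer x 1 = x" by simp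
  show 2: "pochhammer x 2 = x * (x + 1)" using pochhammer_Suc[of x 1] by (simp add: numeral_2_eq_2)
  show 3: "pochhammer x 3 = x * (x + 1) * (x + 2)" using pochhammer_Suc[of x 2] 2 by simp
  show "pochhammer x 4 = x * (x + 1) * (x + 2) * (x + 3)" using pochhammer_Suc[of x 3] 3 by simp
qed

lemma replicate_numerals:
  "replicate 1 x = [x]" "replicate 2 x = [x, x]" "replicate 3 x = [x, x, x]" "replicate 4 x = [x, x, x, x]"
  by (simp_all add: numeral_eq_Suc)
lemma (in mobius_eigen) derivative_bounds_abs:
  assumes z: "Re z \<ge> 0" and e: "e \<in> {1, \<i>}" and j: "j \<in> {1..4}"
  shows "\<bar>pd (replicate j e) v z\<bar> / v z \<le> pochhammer (2 * s) j / g ^ j"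
proof -
  have g0: "g > 0" using g1 by simp
  note p = pochhammer_numerals[of "2 * s"] and c = derivative_constants[OF g0 s0] and b = derivative_bounds[OF z]
  have abs: "\<bar>pd es v z\<bar> / v z = \<bar>pd es v z / v z\<bar>" for es
    using v_pos[OF z] by simp
  have pos: "0 \<le> 2 * s / g" using s0 g0 by simp
  have "\<bar>pd [1] v z / v z\<bar> \<le> 2 * s / g" "\<bar>pd [\<i>] v z / v z\<bar> \<le> 2 * s / g"
    using b(1,2,9,10) c(4) pos unfolding mult_minus_left minus_divide_left[symmetric] by linarith+
  moreover have "\<bar>pd [1, 1] v z / v z\<bar> \<le> 2 * s * (2 * s + 1) / g\<^sup>2"
    "\<bar>pd [\<i>, \<i>] v z / v z\<bar> \<le> 2 * s * (2 * s + 1) / g\<^sup>2"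
    using b(3,4,11,12) c(1,5,6) unfolding mult_minus_left minus_divide_left[symmetric] by linarith+
  moreover have "\<bar>pd [1, 1, 1] v z / v z\<bar> \<le> 2 * s * (2 * s + 1) * (2 * s + 2) / g ^ 3"
    "\<bar>pd [\<i>, \<i>, \<i>] v z / v z\<bar> \<le> 2 * s * (2 * s + 1) * (2 * s + 2) / g ^ 3"
    using b(5,6,13,14) c(2,7) unfolding mult_minus_left minus_divide_left[symmetric] by linarith+
  moreover have "\<bar>pd [1, 1, 1, 1] v z / v z\<bar> \<le> 2 * s * (2 * s + 1) * (2 * s + 2) * (2 * s + 3) / g ^ 4"
    "\<bar>pd [\<i>, \<i>, \<i>, \<i>] v z / v z\<bar> \<le> 2 * s * (2 * s + 1) * (2 * s + 2) * (2 * s + 3) / g ^ 4"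
    using b(7,8,15,16) c(3) unfolding mult_minus_left minus_divide_left[symmetric] by linarith+
  ultimately have f: "\<bar>pd [e] v z / v z\<bar> \<le> 2 * s / g"
    "\<bar>pd [e, e] v z / v z\<bar> \<le> 2 * s * (2 * s + 1) / g\<^sup>2"
    "\<bar>pd [e, e, e] v z / v z\<bar> \<le> 2 * s * (2 * s + 1) * (2 * s + 2) / g ^ 3"
    "\<bar>pd [e, e, e, e] v z / v z\<bar> \<le> 2 * s * (2 * s + 1) * (2 * s + 2) * (2 * s + 3) / g ^ 4"
    using e by blast+
  have "j = 1 \<or> j = 2 \<or> j = 3 \<or> j = 4" using j by auto
  then show ?thesis
  proof (elim disjE)
    assume "j = 1" show ?thesis unfolding \<open>j = 1\<close> replicate_numerals p abs power_one_right by (rule f)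
  next
    assume "j = 2" show ?thesis unfolding \<open>j = 2\<close> replicate_numerals p abs by (rule f)
  next
    assume "j = 3" show ?thesis unfolding \<open>j = 3\<close> replicate_numerals p abs by (rule f)
  next
    assume "j = 4" show ?thesis unfolding \<open>j = 4\<close> replicate_numerals p abs by (rule f)
  qed
qed

section \<open>Application to the closure of H\<close>

theorem theorem7p10:
  fixes B :: "complex set" and \<gamma> s :: real and H :: "complex set" and m :: nat
  assumes "finite B" and "B \<noteq> {}"
    and "\<gamma> \<ge> 1" and "\<forall>\<beta>\<in>B. Re \<beta> \<ge> \<gamma>"
    and "s > 0"
    and "open H" and "bounded H" and "mildly_regular H"
    and "{z. cmod (z - 1 / (2 * \<gamma>)) < 1 / (2 * \<gamma>)} \<subseteq> H"
    and "\<forall>z\<in>H. Re z > 0"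
    and "m \<ge> 1"
  shows "\<exists>v. pos_eigvec m H B s v
     \<and> (\<forall>w. pos_eigvec m H B s w \<longrightarrow> (\<exists>c>0. \<forall>z\<in>closure H. w z = c * v z))
     \<and> (\<forall>k. Cm_bar k H v)
     \<and> (\<forall>z\<in>closure H.
          let Dx = (\<lambda>j. pd_bar H (replicate j 1) v z / v z);
              Dy = (\<lambda>j. pd_bar H (replicate j \<i>) v z / v z) in
          - 2 * s / \<gamma> \<le> Dx 1 \<and> Dx 1 \<le> 0 \<and>
          - s / (4 * \<gamma>^2 * (s + 1)) \<le> Dx 2 \<and> Dx 2 \<le> 2 * s * (2 * s + 1) / \<gamma>^2 \<and>
          - 2 * s * (2 * s + 1) * (2 * s + 2) / \<gamma>^3 \<le> Dx 3 \<and>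
            Dx 3 \<le> (2 * s) * (2 * s + 2) / (\<gamma>^3 * (s + 2)^2) \<and>
          - 2 * s * (2 * s + 2) * (3 * s + 3) / \<gamma>^4 \<le> Dx 4 \<and>
            Dx 4 \<le> (2 * s) * (2 * s + 1) * (2 * s + 2) * (2 * s + 3) / \<gamma>^4 \<and>
          \<bar>Dy 1\<bar> \<le> s / \<gamma> \<and>
          - 2 * s / \<gamma>^2 \<le> Dy 2 \<and> Dy 2 \<le> 2 * s * (2 * s + 1) / (4 * \<gamma>^2) \<and>
          \<bar>Dy 3\<bar> \<le> (2 * s) * (2 * s + 2) / \<gamma>^3 * max (25 * sqrt 5 / 72) ((2 * s + 1) / 8) \<and>
          - 2 * s * (2 * s + 2) * (3 * s + 3) / \<gamma>^4 \<le> Dy 4 \<and>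
            Dy 4 \<le> (2 * s) * (2 * s + 1) * (2 * s + 2) * (2 * s + 3) / \<gamma>^4 \<and>
          (\<forall>e\<in>{1, \<i>}. \<forall>j\<in>{1..4}.
             \<bar>pd_bar H (replicate j e) v z\<bar> / v z \<le> pochhammer (2 * s) j / \<gamma>^j))"
proof -
  interpret mobius_system B \<gamma> s using assms by unfold_locales auto
  obtain L r where L: "mobius_eigen B \<gamma> s L r" using mobius_eigen_exists by blast
  interpret mobius_eigen B \<gamma> s L r by (rule L)
  define X where "X = closure H"
  have "closure H \<subseteq> {z. Re z \<ge> 0}"
    using assms(10) by (intro closure_minimal closed_halfspace_Re_ge) auto
  then have Re_X: "Re z \<ge> 0" if "z \<in> X" for z using that by (auto simp: X_def)
  have XU: "closure H \<subseteq> U" using Re_X nonneg_U by (auto simp: X_def)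
  have compX: "compact X" unfolding X_def using assms(7) by (simp add: compact_closure)
  have c: "complex_of_real (1 / (2 * \<gamma>)) = 1 / (2 * \<gamma>)" by simp
  have ball: "ball (complex_of_real (1 / (2 * \<gamma>))) (1 / (2 * \<gamma>)) \<subseteq> H"
    using assms(9) by (auto simp: dist_norm norm_minus_commute)
  have cballX: "cball (complex_of_real (1 / (2 * \<gamma>))) (1 / (2 * \<gamma>)) \<subseteq> X"
    using closure_mono[OF ball] g1 by (simp add: X_def)
  \<comment> \<open>Inversion carries the half plane Re w >= \<gamma> into the closed disc bounded
    by the circle of G_\<gamma>, so containing G_\<gamma> makes the closure of H invariant under
    every branch.\<close>
  have invX: "inverse (z + \<beta>) \<in> X" if "z \<in> X" "\<beta> \<in> B" for z \<beta>
  proof -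
    have "Re (z + \<beta>) \<ge> \<gamma>" using Re_X[OF that(1)] ReB[OF that(2)] by simp
    moreover have "cmod (inverse w - complex_of_real (1 / (2 * \<gamma>))) \<le> 1 / (2 * \<gamma>)" if w: "Re w \<ge> \<gamma>" for w
    proof -
      have w0: "w \<noteq> 0" "\<gamma> > 0" using w g1 by auto
      \<comment> \<open>Re w >= \<gamma> says that w is at least as close to 2 \<gamma> as to 0;
        dividing by 2 \<gamma> |w| gives the disc.\<close>
      have "(cmod (2 * \<gamma> - w))\<^sup>2 \<le> (cmod w)\<^sup>2"
        unfolding cmod_power2 using mult_left_mono[OF w, of "4 * \<gamma>"] w0(2)
        by (simp add: power2_eq_square algebra_simps)
      then have le: "cmod (2 * \<gamma> - w) \<le> cmod w" by (rule power2_le_imp_le) simp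
      have "inverse w - complex_of_real (1 / (2 * \<gamma>)) = (2 * \<gamma> - w) / (2 * \<gamma> * w)"
        using w0 by (simp add: field_simps)
      then have "cmod (inverse w - complex_of_real (1 / (2 * \<gamma>))) = cmod (2 * \<gamma> - w) / (2 * \<gamma> * cmod w)"
        using w0 by (simp add: norm_divide norm_mult)
      also have "\<dots> \<le> cmod w / (2 * \<gamma> * cmod w)" using le w0 by (intro divide_right_mono) auto
      finally show ?thesis using w0 by simp
    qed
    ultimately show ?thesis
      by (intro subsetD[OF cballX]) (simp add: dist_norm norm_minus_commute)
  qed
  have X_ne: "X \<noteq> {}" using cballX g1 by auto
  have Cm: "Cm_bar k H v" for k by (rule v_Cm_bar[OF XU])
  have eigv: "pos_eigvec m H B s v"
    unfolding pos_eigvec_def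
  proof (intro conjI ballI exI)
    fix z assume "z \<in> closure H"
    then have "Re z \<ge> 0" using Re_X by (simp add: X_def)
    then show "v z > 0" "Lam B s v z = r * v z" by (rule v_pos v_eigen)+
  qed (rule Cm)
  have uniq: "\<exists>c>0. \<forall>z\<in>closure H. w z = c * v z" if w: "pos_eigvec m H B s w" for w
  proof -
    obtain \<mu> where \<mu>: "\<And>z. z \<in> X \<Longrightarrow> Lam B s w z = \<mu> * w z"
      using w by (auto simp: pos_eigvec_def X_def)
    have w': "continuous_on X w" "\<And>z. z \<in> X \<Longrightarrow> w z > 0"
      using w by (auto simp: pos_eigvec_def Cm_bar_def X_def)
    have v': "continuous_on X v" using Cm[of 0] by (simp add: Cm_bar_def X_def)
    have "\<exists>c>0. \<forall>z\<in>X. w z = c * v z"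
      by (rule positive_eigenvector_unique[OF compX X_ne Re_X invX w' \<mu> v' v_pos[OF Re_X] v_eigen[OF Re_X]])
    then show ?thesis by (simp add: X_def)
  qed
  have bar: "pd_bar H (replicate j e) v z = pd (replicate j e) v z" if "z \<in> closure H" "e \<in> {1, \<i>}" for j e z
    using that by (intro pd_bar_v assms XU) (auto simp: set_replicate_conv_if)
  show ?thesis
  proof (intro exI[of _ v] conjI ballI allI impI eigv uniq Cm)
    fix z assume z: "z \<in> closure H"
    then have Rz: "Re z \<ge> 0" using Re_X by (simp add: X_def)
    note b = derivative_bounds[OF Rz]
    have y: "\<bar>pd [\<i>] v z / v z\<bar> \<le> s / \<gamma>"
      "\<bar>pd [\<i>, \<i>, \<i>] v z / v z\<bar> \<le> (2 * s) * (2 * s + 2) / \<gamma>^3 * max (25 * sqrt 5 / 72) ((2 * s + 1) / 8)"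
      using b(9,10,13,14) by linarith+
    have bar1: "pd_bar H (replicate j 1) v z = pd (replicate j 1) v z"
      and bari: "pd_bar H (replicate j \<i>) v z = pd (replicate j \<i>) v z" for j
      by (rule bar[OF z]; simp)+
    have all: "\<forall>e\<in>{1, \<i>}. \<forall>j\<in>{1..4}. \<bar>pd_bar H (replicate j e) v z\<bar> / v z \<le> pochhammer (2 * s) j / \<gamma>^j"
    proof (intro ballI)
      fix e j assume e: "e \<in> {1, \<i>}" and j: "j \<in> {1..4::nat}"
      show "\<bar>pd_bar H (replicate j e) v z\<bar> / v z \<le> pochhammer (2 * s) j / \<gamma>^j"
        unfolding bar[OF z e] by (rule derivative_bounds_abs[OF Rz e j])
    qed
    show "let Dx = (\<lambda>j. pd_bar H (replicate j 1) v z / v z);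
              Dy = (\<lambda>j. pd_bar H (replicate j \<i>) v z / v z) in
          - 2 * s / \<gamma> \<le> Dx 1 \<and> Dx 1 \<le> 0 \<and>
          - s / (4 * \<gamma>^2 * (s + 1)) \<le> Dx 2 \<and> Dx 2 \<le> 2 * s * (2 * s + 1) / \<gamma>^2 \<and>
          - 2 * s * (2 * s + 1) * (2 * s + 2) / \<gamma>^3 \<le> Dx 3 \<and>
            Dx 3 \<le> (2 * s) * (2 * s + 2) / (\<gamma>^3 * (s + 2)^2) \<and>
          - 2 * s * (2 * s + 2) * (3 * s + 3) / \<gamma>^4 \<le> Dx 4 \<and>
            Dx 4 \<le> (2 * s) * (2 * s + 1) * (2 * s + 2) * (2 * s + 3) / \<gamma>^4 \<and>
          \<bar>Dy 1\<bar> \<le> s / \<gamma> \<and>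
          - 2 * s / \<gamma>^2 \<le> Dy 2 \<and> Dy 2 \<le> 2 * s * (2 * s + 1) / (4 * \<gamma>^2) \<and>
          \<bar>Dy 3\<bar> \<le> (2 * s) * (2 * s + 2) / \<gamma>^3 * max (25 * sqrt 5 / 72) ((2 * s + 1) / 8) \<and>
          - 2 * s * (2 * s + 2) * (3 * s + 3) / \<gamma>^4 \<le> Dy 4 \<and>
            Dy 4 \<le> (2 * s) * (2 * s + 1) * (2 * s + 2) * (2 * s + 3) / \<gamma>^4 \<and>
          (\<forall>e\<in>{1, \<i>}. \<forall>j\<in>{1..4}.
             \<bar>pd_bar H (replicate j e) v z\<bar> / v z \<le> pochhammer (2 * s) j / \<gamma>^j)"
      unfolding Let_def bar1 bari replicate_numerals by (intro conjI b y all)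
  qed
qed

end
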